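(* For every ordinal $\alpha<\omega_1$, there is a finitely generated group $G$ satisfying the minimal condition on centralizers such that $\rho(T_G)\geq\alpha$, where $T_G$ is the centralizer tree of $G$.
   Context: Let $\mathbb{F}_\omega$ be the free group on countably many letters, with a fixed enumeration $(\gamma_i)_{i\in\mathbb{N}}$ of its elements. A marked group is $G=\mathbb{F}_\omega/N$ with $N\trianglelefteq\mathbb{F}_\omega$; it carries the enumeration $g_i:=\gamma_iN$, $i\in\mathbb{N}$ (repetitions allowed). For $s=(s_0,\dots,s_n)\in\mathbb{N}^{<\mathbb{N}}$ write $\{g_s\}=\{g_{s_0},\dots,g_{s_n}\}$, with $\{g_\emptyset\}=\emptyset$. $G$ satisfies the minimal condition on centralizers if there is no infinite strictly decreasing chain $C_0>C_1>\cdots$ of subgroups of $G$ of the form $C_i=C_G(A_i)$ with $A_i\subseteq G$. The centralizer tree $T_G\subseteq\mathbb{N}^{<\mathbb{N}}$ is defined recursively, writing $(s,i)$ for the sequence $s$ extended by the term $i$: $\emptyset\in T_G$; and if $s\in T_G$ and $i\in\mathbb{N}$, then $(s,i)\in T_G$ if and only if $C_G(\{g_s\}\cup\{g_i\})\ne C_G(\{g_s\})$ (where $C_G(\emptyset)=G$). The value $\rho(T_G)$ does not depend on the marking of $G$. A tree is a set $T\subseteq\mathbb{N}^{<\mathbb{N}}$ closed under initial segments; it is well-founded if there is no $x\in\mathbb{N}^{\mathbb{N}}$ all of whose finite initial segments lie in $T$. For a nonempty well-founded tree $T$, define $\rho_T(t)=\sup\{\rho_T(s)+1\mid s\in T,\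 t\subsetneq s\}$ (so $\rho_T(t)=0$ if $t$ has no proper extension in $T$) and $\rho(T)=\rho_T(\emptyset)+1$; put $\rho(\emptyset)=0$, and $\rho(T)=\omega_1$ if $T$ is not well-founded. *)

theory Defs
  imports
    "HOL-Algebra.Coset"
    "HOL-Algebra.Generated_Groups"
    "HOL-Library.Sublist"
    "HOL-Library.Countable_Set"
begin

section \<open>Ordinals up to the first uncountable one\<close>

lemma Well_order_cardSuc_natLeq: "Well_order (cardSuc natLeq)"
  using cardSuc_Card_order natLeq_Card_order card_order_on_well_order_on by blast

text \<open>
  An element of the following type is the order type of a well-order that is not longer than
  the initial ordinal \<open>cardSuc natLeq\<close>, that is, than \<open>\<omega>\<^sub>1\<close>.  So the type is the ordinal
  \<open>\<omega>\<^sub>1 + 1\<close>, which is exactly the range of the tree rank.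
\<close>

quotient_type ordinal = "nat set rel" / partial:
  "\<lambda>r s. Well_order r \<and> (r, cardSuc natLeq) \<in> ordLeq \<and>
         Well_order s \<and> (s, cardSuc natLeq) \<in> ordLeq \<and> (r, s) \<in> ordIso"
proof (rule part_equivpI)
  let ?R = "\<lambda>(r::nat set rel) (s::nat set rel).
         Well_order r \<and> (r, cardSuc natLeq) \<in> ordLeq \<and>
         Well_order s \<and> (s, cardSuc natLeq) \<in> ordLeq \<and> (r, s) \<in> ordIso"
  have "?R (cardSuc natLeq) (cardSuc natLeq)"
    by (simp add: Well_order_cardSuc_natLeq ordLeq_reflexive ordIso_reflexive)
  then show "\<exists>x. ?R x x" by blast
  show "symp ?R"
    by (intro sympI) (auto intro: ordIso_symmetric)
  show "transp ?R"
    by (intro transpI) (auto intro: ordIso_transitive)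
qed

instantiation ordinal :: linorder
begin

lift_definition less_eq_ordinal :: "ordinal \<Rightarrow> ordinal \<Rightarrow> bool" is "\<lambda>r s. (r, s) \<in> ordLeq"
  by (meson ordIso_ordLeq_trans ordIso_symmetric ordLeq_ordIso_trans)

lift_definition less_ordinal :: "ordinal \<Rightarrow> ordinal \<Rightarrow> bool" is "\<lambda>r s. (r, s) \<in> ordLess"
  by (meson ordIso_ordLess_trans ordIso_symmetric ordLess_ordIso_trans)

instance
proof
  fix x y z :: ordinal
  show "(x < y) = (x \<le> y \<and> \<not> y \<le> x)"
    by transfer (metis not_ordLess_ordLeq not_ordLeq_iff_ordLess ordLess_imp_ordLeq)
  show "x \<le> x"
    by transfer (simp add: ordLeq_reflexive)
  show "x \<le> y \<Longrightarrow> y \<le> z \<Longrightarrow> x \<le> z"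
    by transfer (rule ordLeq_transitive)
  show "x \<le> y \<Longrightarrow> y \<le> x \<Longrightarrow> x = y"
    by transfer (simp add: ordIso_iff_ordLeq)
  show "x \<le> y \<or> y \<le> x"
    by transfer (simp add: ordLeq_total)
qed

end

lemma wf_less_ordinal: "wf {(x, y :: ordinal). x < y}"
proof (rule wf_subset)
  show "wf (inv_image ordLess rep_ordinal)"
    by (intro wf_inv_image wf_ordLess)
  show "{(x, y). x < y} \<subseteq> inv_image ordLess rep_ordinal"
    by (auto simp: less_ordinal.rep_eq)
qed

instance ordinal :: wellorder
proof
  fix P :: "ordinal \<Rightarrow> bool" and a
  assume *: "\<And>x. (\<And>y. y < x \<Longrightarrow> P y) \<Longrightarrow> P x"
  show "P a"
  proof (induction a rule: wf_induct_rule[OF wf_less_ordinal])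
    case (1 x)
    show ?case
      by (rule *) (rule 1, simp)
  qed
qed

lemma empty_ordLeq: "Well_order r \<Longrightarrow> ({}, r) \<in> ordLeq"
  unfolding ordLeq_def embed_def by (auto simp: bij_betw_def)

lift_definition omega1 :: ordinal is "cardSuc natLeq"
  by (simp add: Well_order_cardSuc_natLeq ordLeq_reflexive ordIso_reflexive)

instantiation ordinal :: zero
begin

lift_definition zero_ordinal :: ordinal is "{}"
  using Well_order_cardSuc_natLeq
  by (auto simp: empty_ordLeq ordIso_reflexive intro: well_order_on_empty)

instance ..

end

lemma ordinal_le_omega1: "a \<le> omega1"
  by transfer simp

lemma zero_le_ordinal: "0 \<le> (a :: ordinal)"
  by transfer (simp add: empty_ordLeq)

instantiation ordinal :: complete_linorder
begin

definition bot_ordinal :: ordinal where "bot_ordinal = 0"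
definition top_ordinal :: ordinal where "top_ordinal = omega1"
definition sup_ordinal :: "ordinal \<Rightarrow> ordinal \<Rightarrow> ordinal" where "sup_ordinal = max"
definition inf_ordinal :: "ordinal \<Rightarrow> ordinal \<Rightarrow> ordinal" where "inf_ordinal = min"
definition Sup_ordinal :: "ordinal set \<Rightarrow> ordinal" where
  "Sup_ordinal A = (LEAST b. \<forall>a\<in>A. a \<le> b)"
definition Inf_ordinal :: "ordinal set \<Rightarrow> ordinal" where
  "Inf_ordinal A = (if A = {} then omega1 else (LEAST a. a \<in> A))"

instance
proof
  fix x y z :: ordinal and A :: "ordinal set"
  have "\<forall>a\<in>A. a \<le> Sup A"
    unfolding Sup_ordinal_def by (rule LeastI[where k = omega1]) (simp add: ordinal_le_omega1)
  then show "x \<in> A \<Longrightarrow> x \<le> Sup A" by blast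
  show "(\<And>x. x \<in> A \<Longrightarrow> x \<le> z) \<Longrightarrow> Sup A \<le> z"
    unfolding Sup_ordinal_def by (rule Least_le) blast
  show "Inf A \<le> x" if "x \<in> A"
    using that Least_le[of "\<lambda>a. a \<in> A" x] by (auto simp: Inf_ordinal_def)
  show "z \<le> Inf A" if *: "\<And>x. x \<in> A \<Longrightarrow> z \<le> x"
  proof (cases "A = {}")
    case True
    then show ?thesis by (simp add: Inf_ordinal_def ordinal_le_omega1)
  next
    case False
    then obtain a where "a \<in> A" by blast
    then have "Inf A \<in> A"
      using LeastI[of "\<lambda>a. a \<in> A" a] False by (simp add: Inf_ordinal_def)
    then show ?thesis by (rule *)
  qed
  show "Inf ({} :: ordinal set) = top_class.top"
    by (simp add: Inf_ordinal_def top_ordinal_def)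
  show "Sup ({} :: ordinal set) = bot_class.bot"
    unfolding Sup_ordinal_def bot_ordinal_def
    by (rule Least_equality) (simp_all add: zero_le_ordinal)
qed (simp_all add: sup_ordinal_def inf_ordinal_def)

end

text \<open>
  The successor \<open>a + 1\<close> of every countable ordinal; only at \<open>\<omega>\<^sub>1\<close> itself, which has no successor
  inside the type, it takes the value \<open>\<omega>\<^sub>1\<close>.
\<close>

definition ord_succ :: "ordinal \<Rightarrow> ordinal" where
  "ord_succ a = Inf {b. a < b}"

lemma less_ord_succ:
  assumes "a < omega1"
  shows "a < ord_succ a"
proof -
  have "(LEAST b. b \<in> {b. a < b}) \<in> {b. a < b}"
    by (rule LeastI[where k = omega1]) (simp add: assms)
  moreover have "{b. a < b} \<noteq> {}"
    using assms by blast
  ultimately show ?thesis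
    unfolding ord_succ_def Inf_ordinal_def by simp
qed

lemma ord_succ_le: "a < b \<Longrightarrow> ord_succ a \<le> b"
  unfolding ord_succ_def by (rule Inf_lower) simp

lemma Well_order_rep_ordinal: "Well_order (rep_ordinal a)"
  and rep_ordinal_le: "(rep_ordinal a, cardSuc natLeq) \<in> ordLeq"
  using Quotient3_rep_reflp[OF Quotient3_ordinal, of a] by auto

lemma rep_omega1: "(rep_ordinal omega1, cardSuc natLeq) \<in> ordIso"
  using Quotient3_rep_abs[OF Quotient3_ordinal, of "cardSuc natLeq"] Well_order_cardSuc_natLeq
  by (simp add: omega1_def ordLeq_reflexive ordIso_reflexive)

lemma countable_Field_iff: "countable (Field r) \<longleftrightarrow> (card_of (Field r), natLeq) \<in> ordLeq"
proof -
  have "countable (Field r) \<longleftrightarrow> (card_of (Field r), card_of (UNIV :: nat set)) \<in> ordLeq"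
    using card_of_ordLeq[of "Field r" "UNIV :: nat set"] by (auto simp: countable_def)
  then show ?thesis
    using card_of_nat by (meson ordIso_symmetric ordLeq_ordIso_trans)
qed

lemma less_omega1_imp_countable:
  assumes "a < omega1"
  shows "countable {b. b < a}"
proof -
  let ?r = "rep_ordinal a"
  have "(?r, cardSuc natLeq) \<in> ordLess"
    using assms rep_omega1 by (metis less_ordinal.rep_eq ordLess_ordIso_trans)
  then have "(card_of (Field ?r), cardSuc natLeq) \<in> ordLess"
    using card_of_least[OF Well_order_rep_ordinal[of a]] ordLeq_ordLess_trans by blast
  then have count: "countable (Field ?r)"
    unfolding countable_Field_iff
    using cardSuc_ordLeq_ordLess[OF natLeq_Card_order card_of_Card_order] by blast
  have "\<exists>x\<in>Field ?r. (rep_ordinal b, Restr ?r (underS ?r x)) \<in> ordIso" if "b < a" for b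
    using that ordLess_iff_ordIso_Restr[OF Well_order_rep_ordinal Well_order_rep_ordinal]
    by (simp add: less_ordinal.rep_eq)
  then obtain f where f: "\<And>b. b < a \<Longrightarrow> f b \<in> Field ?r"
      "\<And>b. b < a \<Longrightarrow> (rep_ordinal b, Restr ?r (underS ?r (f b))) \<in> ordIso"
    by metis
  have "inj_on f {b. b < a}"
  proof (rule inj_onI)
    fix b c assume bc: "b \<in> {b. b < a}" "c \<in> {b. b < a}" "f b = f c"
    then have "(rep_ordinal b, rep_ordinal c) \<in> ordIso"
      using f(2)[of b] f(2)[of c] by (metis mem_Collect_eq ordIso_symmetric ordIso_transitive)
    then show "b = c"
      by (metis antisym less_eq_ordinal.rep_eq ordIso_iff_ordLeq)
  qed
  moreover have "f ` {b. b < a} \<subseteq> Field ?r"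
    using f(1) by blast
  ultimately show ?thesis
    using count by (metis countable_image_inj_on countable_subset)
qed

lemma uncountable_below_omega1: "uncountable {b. b < omega1}"
proof
  assume count: "countable {b. b < omega1}"
  let ?r = "cardSuc natLeq" and ?g = "\<lambda>x. abs_ordinal (Restr (cardSuc natLeq) (underS (cardSuc natLeq) x))"
  note wo = Well_order_cardSuc_natLeq
  have wr: "wo_rel ?r" by (simp add: wo_rel_def wo)
  have small: "(Restr ?r (underS ?r x), ?r) \<in> ordLess" if "x \<in> Field ?r" for x
    using underS_Restr_ordLess[OF wo] that by blast
  have rep: "(rep_ordinal (?g x), Restr ?r (underS ?r x)) \<in> ordIso" if "x \<in> Field ?r" for x
    using Quotient3_rep_abs[OF Quotient3_ordinal, of "Restr ?r (underS ?r x)"]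
      Well_order_Restr[OF wo] ordLess_imp_ordLeq[OF small[OF that]]
    by (simp add: ordIso_reflexive)
  have "?g x < omega1" if "x \<in> Field ?r" for x
    unfolding less_ordinal.rep_eq
    using rep[OF that] small[OF that] rep_omega1
    by (meson ordIso_ordLess_trans ordIso_symmetric ordLess_ordIso_trans)
  then have sub: "?g ` Field ?r \<subseteq> {b. b < omega1}" by blast
  have "inj_on ?g (Field ?r)"
  proof (rule inj_onI, rule ccontr)
    fix x y assume xy: "x \<in> Field ?r" "y \<in> Field ?r" "?g x = ?g y" "x \<noteq> y"
    have iso: "(Restr ?r (underS ?r x), Restr ?r (underS ?r y)) \<in> ordIso"
      using rep[OF xy(1)] rep[OF xy(2)] xy(3) by (metis ordIso_symmetric ordIso_transitive)
    have "(x, y) \<in> ?r \<or> (y, x) \<in> ?r"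
      using wo_rel.TOTAL[OF wr] xy by (auto simp: total_on_def)
    then have "underS ?r x \<subset> underS ?r y \<or> underS ?r y \<subset> underS ?r x"
      using xy(4) wo_rel.TRANS[OF wr] wo_rel.ANTISYM[OF wr] unfolding underS_def trans_def antisym_def psubset_eq by blast
    then show False
      using ofilter_subset_ordLess[OF wo wo_rel.underS_ofilter[OF wr] wo_rel.underS_ofilter[OF wr]] iso
        not_ordLess_ordIso ordIso_symmetric by metis
  qed
  then have "countable (Field ?r)"
    using countable_image_inj_on[OF countable_subset[OF sub count]] by blast
  then have "(card_of (Field ?r), natLeq) \<in> ordLeq"
    by (simp add: countable_Field_iff)
  moreover have "(natLeq, card_of (Field ?r)) \<in> ordLess"
    using cardSuc_greater[OF natLeq_Card_order]
      card_of_Field_ordIso[OF cardSuc_Card_order[OF natLeq_Card_order]]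
    by (meson ordIso_symmetric ordLess_ordIso_trans)
  ultimately show False
    using not_ordLess_ordLeq by blast
qed

lemma less_omega1_iff_countable: "a < omega1 \<longleftrightarrow> countable {b. b < a}"
proof
  assume "countable {b. b < a}"
  then have "a \<noteq> omega1"
    using uncountable_below_omega1 by blast
  then show "a < omega1"
    using ordinal_le_omega1[of a] by simp
qed (rule less_omega1_imp_countable)

lemma Sup_countable_less_omega1:
  assumes "countable A" "\<And>a. a \<in> A \<Longrightarrow> a < omega1"
  shows "Sup A < omega1"
proof (rule ccontr)
  assume "\<not> Sup A < omega1"
  then have "Sup A = omega1"
    using ordinal_le_omega1 by (metis leI antisym)
  have "{b. b < omega1} \<subseteq> (\<Union>a\<in>A. {b. b < a})"
    unfolding \<open>Sup A = omega1\<close>[symmetric] using less_Sup_iff by blast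
  moreover have "countable (\<Union>a\<in>A. {b. b < a})"
    using assms by (auto intro!: countable_UN less_omega1_imp_countable)
  ultimately have "countable {b. b < omega1}"
    using countable_subset by blast
  then show False
    using uncountable_below_omega1 by blast
qed

lemma ord_succ_less_omega1:
  assumes "a < omega1"
  shows "ord_succ a < omega1"
proof -
  have "{b. b < ord_succ a} \<subseteq> insert a {b. b < a}"
  proof
    fix b assume "b \<in> {b. b < ord_succ a}"
    then have "\<not> a < b"
      using ord_succ_le leD by blast
    then show "b \<in> insert a {b. b < a}"
      by (auto simp: not_less order_le_less)
  qed
  with assms show ?thesis
    unfolding less_omega1_iff_countable by (meson countable_insert countable_subset)
qed


section \<open>Trees and their rank\<close>

definition is_tree :: "nat list set \<Rightarrow> bool" where
  "is_tree T \<longleftrightarrow> (\<forall>t\<in>T. \<forall>s. prefix s t \<longrightarrow> s \<in> T)"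

definition well_founded_tree :: "nat list set \<Rightarrow> bool" where
  "well_founded_tree T \<longleftrightarrow> \<not> (\<exists>x :: nat \<Rightarrow> nat. \<forall>n. map x [0..<n] \<in> T)"

definition extension_rel :: "nat list set \<Rightarrow> nat list rel" where
  "extension_rel T = {(s, t). s \<in> T \<and> t \<in> T \<and> strict_prefix t s}"

text \<open>
  The recursion for the rank of a node of a well-founded tree is \<open>node_rank_eq\<close> below.  These
  ranks are countable (\<open>node_rank_less_omega1\<close>), so \<open>ord_succ\<close> is only ever the true successor.
\<close>

definition node_rank :: "nat list set \<Rightarrow> nat list \<Rightarrow> ordinal" where
  "node_rank T = wfrec (extension_rel T)
     (\<lambda>f t. SUP s\<in>{s \<in> T. strict_prefix t s}. ord_succ (f s))"

definition tree_rank :: "nat list set \<Rightarrow> ordinal" where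
  "tree_rank T =
     (if T = {} then 0
      else if well_founded_tree T then ord_succ (node_rank T [])
      else omega1)"

lemma wf_extension_rel:
  assumes "is_tree T" "well_founded_tree T"
  shows "wf (extension_rel T)"
  unfolding wf_iff_no_infinite_down_chain
proof
  assume "\<exists>f. \<forall>i. (f (Suc i), f i) \<in> extension_rel T"
  then obtain f where f: "\<And>i. f i \<in> T" "\<And>i. strict_prefix (f i) (f (Suc i))"
    by (auto simp: extension_rel_def)
  have mono: "prefix (f i) (f j)" if "i \<le> j" for i j
    using that
  proof (induction rule: dec_induct)
    case (step n)
    then show ?case
      using f(2)[of n] by (auto simp: prefix_def strict_prefix_def)
  qed simp
  have len: "n \<le> length (f n)" for n
  proof (induction n)
    case (Suc n)
    then show ?case
      using prefix_length_less[OF f(2)[of n]] by simp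
  qed simp
  define x where "x n = f (Suc n) ! n" for n
  have "map x [0..<n] \<in> T" for n
  proof -
    have "x m = f n ! m" if "m < n" for m
      using mono[of "Suc m" n] len[of "Suc m"] that
      by (auto simp: x_def prefix_def nth_append)
    then have "map x [0..<n] = take n (f n)"
      using len[of n] by (intro nth_equalityI) auto
    then show ?thesis
      using f(1)[of n] assms(1) by (metis is_tree_def take_is_prefix)
  qed
  with assms(2) show False
    by (auto simp: well_founded_tree_def)
qed

lemma node_rank_eq:
  assumes "is_tree T" "well_founded_tree T" "t \<in> T"
  shows "node_rank T t = (SUP s\<in>{s \<in> T. strict_prefix t s}. ord_succ (node_rank T s))"
  using assms(3)
  by (subst node_rank_def, subst wfrec[OF wf_extension_rel[OF assms(1,2)]])
     (auto simp: node_rank_def cut_apply extension_rel_def intro!: SUP_cong)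

lemma node_rank_less_omega1:
  assumes "is_tree T" "well_founded_tree T" "t \<in> T"
  shows "node_rank T t < omega1"
  using assms(3)
proof (induction t rule: wf_induct_rule[OF wf_extension_rel[OF assms(1,2)]])
  case (1 t)
  then show ?case
    unfolding node_rank_eq[OF assms(1,2) 1(2)]
    by (intro Sup_countable_less_omega1) (auto simp: extension_rel_def intro: ord_succ_less_omega1)
qed


section \<open>The free group on countably many letters\<close>

text \<open>The letter \<open>(i, True)\<close> stands for the generator \<open>x\<^sub>i\<close>, and \<open>(i, False)\<close> for its inverse.\<close>

type_synonym letter = "nat \<times> bool"

definition inv_letter :: "letter \<Rightarrow> letter" where
  "inv_letter x = (fst x, \<not> snd x)"

fun reduced :: "letter list \<Rightarrow> bool" where
  "reduced (x # y # w) \<longleftrightarrow> y \<noteq> inv_letter x \<and> reduced (y # w)"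
| "reduced _ \<longleftrightarrow> True"

fun cons_reduced :: "letter \<Rightarrow> letter list \<Rightarrow> letter list" where
  "cons_reduced x [] = [x]"
| "cons_reduced x (y # w) = (if y = inv_letter x then w else x # y # w)"

text \<open>
  Multiplying the letters of \<open>u\<close> one after the other to the left of the reduced word \<open>v\<close>,
  cancelling when possible, gives the reduced form of the concatenation of \<open>u\<close> and \<open>v\<close>.
\<close>

definition F_omega :: "letter list monoid" where
  "F_omega = \<lparr>carrier = {w. reduced w}, mult = (\<lambda>u v. foldr cons_reduced u v), one = []\<rparr>"

lemma inv_letter_inv_letter [simp]: "inv_letter (inv_letter x) = x"
  by (simp add: inv_letter_def)

lemma reduced_ConsD: "reduced (x # w) \<Longrightarrow> reduced w"
  by (cases w) auto

lemma reduced_cons_reduced: "reduced w \<Longrightarrow> reduced (cons_reduced x w)"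
  by (cases w) (auto dest: reduced_ConsD)

lemma reduced_foldr: "reduced v \<Longrightarrow> reduced (foldr cons_reduced u v)"
  by (induction u) (auto intro: reduced_cons_reduced)

lemma cons_reduced_cancel:
  "reduced w \<Longrightarrow> cons_reduced x (cons_reduced (inv_letter x) w) = w"
  by (cases w rule: reduced.cases) auto

lemma foldr_cons_reduced:
  assumes "reduced w"
  shows "foldr cons_reduced (cons_reduced x v) w = cons_reduced x (foldr cons_reduced v w)"
  using cons_reduced_cancel[OF reduced_foldr[OF assms]] by (cases v) auto

lemma foldr_cons_reduced_assoc:
  assumes "reduced w"
  shows "foldr cons_reduced (foldr cons_reduced u v) w
    = foldr cons_reduced u (foldr cons_reduced v w)"
  by (induction u) (simp_all add: foldr_cons_reduced[OF assms])

lemma foldr_cons_reduced_Nil: "reduced w \<Longrightarrow> foldr cons_reduced w [] = w"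
  by (induction w rule: reduced.induct) auto

lemma foldr_cons_reduced_inverse:
  "reduced w \<Longrightarrow> foldr cons_reduced (rev (map inv_letter u)) (foldr cons_reduced u w) = w"
proof (induction u arbitrary: w)
  case (Cons x u)
  then show ?case
    using cons_reduced_cancel[OF reduced_foldr[OF Cons.prems], of "inv_letter x" u] by simp
qed simp

lemma group_F_omega: "group F_omega"
proof (rule groupI)
  fix w assume "w \<in> carrier F_omega"
  then have w: "reduced w" by (simp add: F_omega_def)
  let ?v = "foldr cons_reduced (rev (map inv_letter w)) []"
  have "foldr cons_reduced ?v w = foldr cons_reduced (rev (map inv_letter w)) w"
    using foldr_cons_reduced_assoc[OF w] by simp
  also have "\<dots> = []"
    using foldr_cons_reduced_inverse[of "[]" w] by (simp add: foldr_cons_reduced_Nil[OF w])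
  finally show "\<exists>v\<in>carrier F_omega. v \<otimes>\<^bsub>F_omega\<^esub> w = \<one>\<^bsub>F_omega\<^esub>"
    by (intro bexI[of _ ?v]) (simp_all add: F_omega_def reduced_foldr)
qed (auto simp: F_omega_def reduced_foldr foldr_cons_reduced_assoc)


section \<open>Groups and centralizer trees\<close>

definition finitely_generated :: "('a, 'b) monoid_scheme \<Rightarrow> bool" where
  "finitely_generated G \<longleftrightarrow> (\<exists>S. finite S \<and> S \<subseteq> carrier G \<and> generate G S = carrier G)"

definition centralizer :: "('a, 'b) monoid_scheme \<Rightarrow> 'a set \<Rightarrow> 'a set" where
  "centralizer G A = {x \<in> carrier G. \<forall>a\<in>A. x \<otimes>\<^bsub>G\<^esub> a = a \<otimes>\<^bsub>G\<^esub> x}"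

definition min_condition_centralizers :: "('a, 'b) monoid_scheme \<Rightarrow> bool" where
  "min_condition_centralizers G \<longleftrightarrow>
     \<not> (\<exists>C :: nat \<Rightarrow> 'a set.
          (\<forall>i. \<exists>A. A \<subseteq> carrier G \<and> C i = centralizer G A) \<and> (\<forall>i. C (Suc i) \<subset> C i))"

text \<open>Here \<open>g\<close> is the enumeration of the elements of the marked group \<open>G\<close>.\<close>

inductive_set centralizer_tree ::
    "('a, 'b) monoid_scheme \<Rightarrow> (nat \<Rightarrow> 'a) \<Rightarrow> nat list set"
  for G :: "('a, 'b) monoid_scheme" and g :: "nat \<Rightarrow> 'a" where
  Nil: "[] \<in> centralizer_tree G g"
| snoc: "s \<in> centralizer_tree G g \<Longrightarrow>
    centralizer G (g ` set s \<union> {g i}) \<noteq> centralizer G (g ` set s) \<Longrightarrow>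
    s @ [i] \<in> centralizer_tree G g"

lemma is_tree_centralizer_tree: "is_tree (centralizer_tree G g)"
proof -
  have "\<forall>s. prefix s t \<longrightarrow> s \<in> centralizer_tree G g" if "t \<in> centralizer_tree G g" for t
    using that by induction (auto simp: centralizer_tree.Nil intro: centralizer_tree.snoc)
  then show ?thesis by (simp add: is_tree_def)
qed

end

theory Submission
  imports Defs "HOL-Library.Product_Plus"
begin

text \<open>
  Call sequences \<open>x\<close>, \<open>y\<close> of group elements a ladder if \<open>y k\<close> commutes with \<open>x j\<close> for all
  \<open>j < k\<close>, but not with \<open>x k\<close>.  An infinite strictly decreasing chain of centralizers yields a
  ladder, and injective homomorphisms carry ladders to ladders.  So it suffices to find a group
  without ladders, not necessarily finitely generated, and to take in it a finitely generated
  subgroup whose centralizer tree has large rank.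

  The rank comes from a well-founded tree: the tree of finite descending sequences of ordinals
  below \<open>\<alpha>\<close> has rank at least \<open>\<alpha>\<close>.  If a group has elements \<open>u\<^sub>\<sigma>\<close> and \<open>w\<^sub>\<sigma>\<close>, indexed by
  these sequences, such that \<open>u\<^sub>\<sigma>\<close> commutes with \<open>w\<^sub>\<tau>\<close> exactly if \<open>\<sigma>\<close> is a prefix of \<open>\<tau>\<close>, then
  along a branch of the tree each new \<open>u\<^sub>\<sigma>\<close> shrinks the centralizer, because \<open>w\<close> at the parent
  of \<open>\<sigma>\<close> drops out of it.  So the tree embeds into the centralizer tree
  (\<open>tree_rank_centralizer_tree_ge\<close>).  On the other hand the prefix relation has no ladder in either
  direction: a ladder would give an infinite branch (\<open>no_ladder_prefix\<close>) or infinitely many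
  prefixes of one sequence (\<open>no_ladder_below_prefix\<close>).

  To make finitely many generators suffice, the relation is spread over \<open>\<int>\<^sup>2\<close>.  Give the sequences
  \<open>\<sigma>\<close> distinct powers of two \<open>s \<sigma>\<close> and consider the bipartite graph on two copies of \<open>\<int>\<^sup>2\<close> in
  which \<open>p\<close> on the left is adjacent to \<open>q\<close> on the right if \<open>q - p = (s \<sigma>, s \<tau>)\<close> for some prefix
  \<open>\<sigma>\<close> of \<open>\<tau>\<close>.  It is invariant under translations, and since a nonzero difference of two powers
  of two determines both powers, every ladder of adjacencies in this graph yields a ladder of the
  prefix relation or of its converse (\<open>relation_ladder_if_translation_ladder\<close>).

  Finally, the graph is turned into a group.  Let \<open>N\<close> be the group of nilpotency class two in which
  commutation of finite vertex sets (vectors over the field with two elements) is dictated by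
  adjacency, and extend \<open>N\<close> by the translations \<open>\<int>\<^sup>2\<close>.  The vertices form two orbits, so the two
  translations and one vertex of each side generate a subgroup that contains all vertices.  An element
  outside \<open>N\<close> has an abelian centralizer that meets \<open>N\<close> trivially, which excludes it from ladders,
  except as their term \<open>y 0\<close> (\<open>set_ladder_if_mekler_ladder\<close>); and because the graph has no triangles, commuting vertex sets
  are so rigid that a ladder of vertex sets yields one of vertices (\<open>graph_ladder_if_set_ladder\<close>).
\<close>

section \<open>Ladders and chains of centralizers\<close>

definition ladder :: "('a \<Rightarrow> 'b \<Rightarrow> bool) \<Rightarrow> (nat \<Rightarrow> 'a) \<Rightarrow> (nat \<Rightarrow> 'b) \<Rightarrow> bool" where
  "ladder C x y \<longleftrightarrow> (\<forall>k. \<not> C (x k) (y k)) \<and> (\<forall>j k. j < k \<longrightarrow> C (x j) (y k))"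

lemma ladder_diag: "ladder C x y \<Longrightarrow> \<not> C (x k) (y k)"
  and ladder_above: "ladder C x y \<Longrightarrow> j < k \<Longrightarrow> C (x j) (y k)"
  by (auto simp: ladder_def)

lemma ladder_tail: "ladder C x y \<Longrightarrow> ladder C (\<lambda>k. x (k + n)) (\<lambda>k. y (k + n))"
  by (auto simp: ladder_def)

lemma inj_ladder_left: "ladder C x y \<Longrightarrow> inj x"
  by (rule injI) (metis ladder_diag ladder_above linorder_neqE_nat)

lemma inj_ladder_right: "ladder C x y \<Longrightarrow> inj y"
  by (rule injI) (metis ladder_diag ladder_above linorder_neqE_nat)

abbreviation commuting :: "('a, 'b) monoid_scheme \<Rightarrow> 'a \<Rightarrow> 'a \<Rightarrow> bool" where
  "commuting G x y \<equiv> x \<otimes>\<^bsub>G\<^esub> y = y \<otimes>\<^bsub>G\<^esub> x"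

text \<open>
  The ladder read off from a strictly decreasing chain of centralizers \<open>C i\<close> of sets \<open>A i\<close>: choose
  \<open>y i\<close> in \<open>C i\<close> but not in \<open>C (Suc i)\<close>, and \<open>x i\<close> in \<open>A (Suc i)\<close> as a witness for the latter.
\<close>

lemma min_condition_centralizersI:
  assumes no_ladder: "\<And>x y. range x \<subseteq> carrier G \<Longrightarrow> range y \<subseteq> carrier G \<Longrightarrow>
    \<not> ladder (commuting G) x y"
  shows "min_condition_centralizers G"
  unfolding min_condition_centralizers_def
proof
  assume "\<exists>C. (\<forall>i. \<exists>A. A \<subseteq> carrier G \<and> C i = centralizer G A) \<and> (\<forall>i. C (Suc i) \<subset> C i)"
  then obtain C A where A: "\<And>i. A i \<subseteq> carrier G" "\<And>i. C i = centralizer G (A i)"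
    and strict: "\<And>i. C (Suc i) \<subset> C i"
    by metis
  have mono: "C k \<subseteq> C j" if "j \<le> k" for j k
    using that strict by (metis lift_Suc_antimono_le psubset_imp_subset)
  have "\<exists>y. y \<in> C i \<and> y \<notin> C (Suc i)" for i
    using strict[of i] by blast
  then obtain y where y: "\<And>i. y i \<in> C i" "\<And>i. y i \<notin> C (Suc i)"
    by metis
  have y_in: "y i \<in> carrier G" for i
    using y(1)[of i] by (simp add: A(2) centralizer_def)
  have "\<exists>x\<in>A (Suc i). \<not> commuting G x (y i)" for i
    using y(2)[of i] y_in[of i] unfolding A(2) centralizer_def mem_Collect_eq by metis
  then obtain x where x: "\<And>i. x i \<in> A (Suc i)" "\<And>i. \<not> commuting G (x i) (y i)"
    by metis
  have "commuting G (x j) (y k)" if "j < k" for j k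
  proof -
    have "y k \<in> C (Suc j)"
      using mono[of "Suc j" k] y(1)[of k] that by auto
    then show ?thesis
      using x(1)[of j] by (auto simp: A(2) centralizer_def)
  qed
  then have "ladder (commuting G) x y"
    using x(2) by (simp add: ladder_def)
  moreover have "range x \<subseteq> carrier G" "range y \<subseteq> carrier G"
    using x(1) A(1) y_in by blast+
  ultimately show False
    using no_ladder by blast
qed

lemma commuting_hom_iff:
  assumes hom: "\<psi> \<in> hom G H" and inj: "inj_on \<psi> (carrier G)" and G: "group G"
    and ab: "a \<in> carrier G" "b \<in> carrier G"
  shows "commuting H (\<psi> a) (\<psi> b) \<longleftrightarrow> commuting G a b"
proof -
  interpret group G
    by (rule G)
  show ?thesis
    using ab hom_mult[OF hom ab] hom_mult[OF hom ab(2,1)] inj_on_eq_iff[OF inj] by (metis m_closed)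
qed

text \<open>
  Since a ladder consists of elements and not of centralizers, it survives in every larger group.
  Thus the absence of ladders, unlike a direct description of the lattice of centralizers, has to be
  checked only in a convenient overgroup.
\<close>

lemma min_condition_centralizers_if_embeds:
  fixes G :: "('a, 'c) monoid_scheme" and H :: "('b, 'd) monoid_scheme"
  assumes hom: "\<psi> \<in> hom G H" and inj: "inj_on \<psi> (carrier G)" and G: "group G"
    and no_ladder: "\<And>x y. range x \<subseteq> carrier H \<Longrightarrow> range y \<subseteq> carrier H \<Longrightarrow> \<not> ladder (commuting H) x y"
  shows "min_condition_centralizers G"
proof (rule min_condition_centralizersI)
  fix x y :: "nat \<Rightarrow> 'a" assume x: "range x \<subseteq> carrier G" and y: "range y \<subseteq> carrier G"
  have "commuting H (\<psi> (x j)) (\<psi> (y k)) \<longleftrightarrow> commuting G (x j) (y k)" for j k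
    using commuting_hom_iff[OF hom inj G] x y by blast
  then have "ladder (commuting H) (\<psi> \<circ> x) (\<psi> \<circ> y) \<longleftrightarrow> ladder (commuting G) x y"
    by (simp add: ladder_def)
  moreover have "range (\<psi> \<circ> x) \<subseteq> carrier H" "range (\<psi> \<circ> y) \<subseteq> carrier H"
    using x y hom_carrier[OF hom] by auto
  ultimately show "\<not> ladder (commuting G) x y"
    using no_ladder by blast
qed

section \<open>Commuting vertex sets in triangle-free graphs\<close>

text \<open>
  In the class-two group constructed below, the commutator of two finite vertex sets records, modulo
  2, the pairs of nonadjacent vertices \<open>x\<close>, \<open>y\<close> with \<open>x\<close> in one set and \<open>y\<close> in the other.  The
  definition says that this commutator vanishes: on every nonadjacent pair the determinant of the
  two indicator vectors is zero.
\<close>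

definition commuting_sets :: "('x \<Rightarrow> 'x \<Rightarrow> bool) \<Rightarrow> 'x set \<Rightarrow> 'x set \<Rightarrow> bool" where
  "commuting_sets E v w \<longleftrightarrow>
    (\<forall>x y. \<not> E x y \<longrightarrow> (x \<in> v \<and> y \<in> w \<longleftrightarrow> x \<in> w \<and> y \<in> v))"

definition joined :: "('x \<Rightarrow> 'x \<Rightarrow> bool) \<Rightarrow> 'x set \<Rightarrow> 'x set \<Rightarrow> bool" where
  "joined E v w \<longleftrightarrow> (\<forall>x\<in>v. \<forall>y\<in>w. E x y)"

text \<open>
  Commutation is linear over the field with two elements, whose addition of vectors is \<open>sym_diff\<close>.
\<close>

lemma commuting_sets_sym_diff:
  "commuting_sets E v w \<Longrightarrow> commuting_sets E v (sym_diff w w') \<longleftrightarrow> commuting_sets E v w'"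
  unfolding commuting_sets_def by blast

locale triangle_free =
  fixes E :: "'x \<Rightarrow> 'x \<Rightarrow> bool"
  assumes sym: "E x y \<Longrightarrow> E y x"
    and triangle_free: "E x y \<Longrightarrow> E y z \<Longrightarrow> \<not> E x z"
begin

lemma commuting_sets_if_joined: "joined E v w \<Longrightarrow> commuting_sets E v w"
  unfolding joined_def commuting_sets_def using sym by blast

text \<open>
  If \<open>v\<close> contains an edge, no vertex is adjacent to both of its ends, so every vertex of \<open>w\<close> is
  nonadjacent to a vertex of \<open>v\<close> and the vanishing determinant forces it into \<open>v\<close>.  Such a \<open>v\<close>
  commutes with finitely many sets only.
\<close>

lemma commuting_set_subset:
  assumes "commuting_sets E v w" "x \<in> v" "y \<in> v" "E x y"
  shows "w \<subseteq> v"
proof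
  fix z assume z: "z \<in> w"
  have "\<not> E x z \<or> \<not> E y z"
    using triangle_free[OF assms(4), of z] by blast
  then show "z \<in> v"
    using assms(1-3) z unfolding commuting_sets_def by blast
qed

text \<open>
  A vertex of \<open>v\<close> outside \<open>w\<close> must be adjacent to all of \<open>w\<close>; then, as \<open>v\<close> is independent, all of
  \<open>w\<close> is disjoint from \<open>v\<close> and joined to it.  If instead \<open>v\<close> is contained in \<open>w\<close>, this applies
  to \<open>w - v\<close>, which commutes with \<open>v\<close> by linearity.  So up to adding \<open>v\<close> itself, the sets that
  commute with \<open>v\<close> are the sets of common neighbours of \<open>v\<close>.
\<close>

lemma commuting_sets_cases:
  assumes comm: "commuting_sets E v w"
    and independent: "\<And>x y. x \<in> v \<Longrightarrow> y \<in> v \<Longrightarrow> \<not> E x y"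
  shows "joined E v w \<or> v \<subseteq> w \<and> joined E v (w - v)"
proof (cases "v \<subseteq> w")
  case True
  have "E x y" if "x \<in> v" "y \<in> w - v" for x y
    using that True comm unfolding commuting_sets_def by blast
  then show ?thesis
    using True by (auto simp: joined_def)
next
  case False
  then obtain x where x: "x \<in> v" "x \<notin> w" by blast
  have w: "E x y" if "y \<in> w" for y
    using x that comm unfolding commuting_sets_def by blast
  have "E x' y" if "x' \<in> v" "y \<in> w" for x' y
    using that w[of y] x(1) independent[of x y] comm unfolding commuting_sets_def by blast
  then show ?thesis
    by (simp add: joined_def)
qed

lemma graph_ladder_if_joined:
  assumes lad: "ladder (commuting_sets E) v w"
    and join: "\<And>j k. j < k \<Longrightarrow> joined E (v j) (w k)"
  shows "\<exists>a b. ladder E a b"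
proof -
  have "\<exists>a b. a \<in> v k \<and> b \<in> w k \<and> \<not> E a b" for k
    using ladder_diag[OF lad, of k] commuting_sets_if_joined[of "v k" "w k"]
    by (auto simp: joined_def)
  then obtain a b where "\<And>k. a k \<in> v k" "\<And>k. b k \<in> w k" "\<And>k. \<not> E (a k) (b k)"
    by metis
  then have "ladder E a b"
    using join by (auto simp: ladder_def joined_def)
  then show ?thesis by blast
qed

text \<open>
  A common neighbour \<open>c\<close> of the right-hand sets makes their union independent.  Then the
  exceptional case of \<open>commuting_sets_cases\<close> shrinks to \<open>w k = v j\<close>, and it occurs for at most one
  \<open>k\<close>: after \<open>w l = v i\<close>, no later \<open>w k\<close> can be joined to \<open>v i\<close> inside the neighbourhood of \<open>c\<close>,
  so \<open>w k = v i\<close> would follow, against injectivity.  Beyond that index \<open>joined\<close> always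
  holds, and vertices can be chosen.
\<close>

lemma graph_ladder_in_neighbourhood:
  assumes lad: "ladder (commuting_sets E) v w"
    and independent: "\<And>k x y. x \<in> v k \<Longrightarrow> y \<in> v k \<Longrightarrow> \<not> E x y"
    and c: "\<And>k y. y \<in> w k \<Longrightarrow> E c y"
  shows "\<exists>a b. ladder E a b"
proof -
  have nonempty: "v k \<noteq> {}" "w k \<noteq> {}" for k
    using ladder_diag[OF lad, of k] by (auto simp: commuting_sets_def)
  have dich: "joined E (v j) (w k) \<or> w k = v j" if "j < k" for j k
  proof -
    have "w k - v j = {}" if join: "v j \<subseteq> w k" "joined E (v j) (w k - v j)"
    proof -
      obtain x where x: "x \<in> v j"
        using nonempty by blast
      have "\<not> E x y" if "y \<in> w k" for y
        using triangle_free[of c x y] c that x join(1) by blast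
      then show ?thesis
        using join(2) x by (auto simp: joined_def)
    qed
    then show ?thesis
      using commuting_sets_cases[OF ladder_above[OF lad that] independent[of _ j]] by blast
  qed
  show ?thesis
  proof (cases "\<forall>j k. j < k \<longrightarrow> joined E (v j) (w k)")
    case True
    then show ?thesis
      using graph_ladder_if_joined[OF lad] by blast
  next
    case False
    then obtain i l where il: "i < l" "w l = v i"
      using dich by blast
    let ?n = "Suc l"
    have "joined E (v (j + ?n)) (w (k + ?n))" if "j < k" for j k
    proof -
      let ?w = "w (k + ?n)"
      obtain x y where xy: "x \<in> w l" "y \<in> ?w"
        using nonempty by blast
      then have "\<not> E x y"
        using triangle_free[of c x y] c by blast
      then have "\<not> joined E (v i) ?w"
        using xy il(2) by (auto simp: joined_def)
      then have "?w = w l"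
        using dich[of i "k + ?n"] il by auto
      then have "k + ?n = l"
        by (rule injD[OF inj_ladder_right[OF lad]])
      then show ?thesis by simp
    qed
    then show ?thesis
      using graph_ladder_if_joined[OF ladder_tail[OF lad, of ?n]] by blast
  qed
qed

text \<open>
  The right-hand sets of a ladder are distinct, so no \<open>v k\<close> commutes with finitely many sets only;
  hence all \<open>v k\<close> are independent.  Fix a vertex \<open>c\<close> of \<open>v 0\<close>.  Each later \<open>w k\<close> either lies in the
  neighbourhood of \<open>c\<close> or does so after \<open>v 0\<close> is removed.  If the second case occurs infinitely
  often, sums of consecutive such sets cancel \<open>v 0\<close> and, by linearity, still form a ladder.
\<close>

theorem graph_ladder_if_set_ladder:
  assumes lad: "ladder (commuting_sets E) v w" and fin: "\<And>k. finite (v k)"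
  shows "\<exists>a b. ladder E a b"
proof -
  have independent: "\<not> E x y" if "x \<in> v k" "y \<in> v k" for k x y
  proof
    assume "E x y"
    then have "w l \<subseteq> v k" if "k < l" for l
      using commuting_set_subset[OF ladder_above[OF lad that]] \<open>x \<in> v k\<close> \<open>y \<in> v k\<close> by blast
    then have "w ` {k<..} \<subseteq> Pow (v k)"
      by auto
    then have "finite {k<..}"
      using fin[of k] inj_ladder_right[OF lad]
      by (meson finite_Pow_iff finite_imageD finite_subset inj_on_subset subset_UNIV)
    then show False
      by (simp add: infinite_Ioi)
  qed
  obtain c where c: "c \<in> v 0"
    using ladder_diag[OF lad, of 0] by (auto simp: commuting_sets_def)
  have dich: "joined E (v 0) (w k) \<or> v 0 \<subseteq> w k \<and> joined E (v 0) (w k - v 0)" if "0 < k" for k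
    using commuting_sets_cases[OF ladder_above[OF lad that] independent[of _ 0]] by blast
  define L where "L = {k. 0 < k \<and> v 0 \<subseteq> w k}"
  show ?thesis
  proof (cases "infinite L")
    case True
    define r where "r = enumerate L"
    have r: "strict_mono r" "\<And>k. r k \<in> L"
      using True by (auto simp: r_def strict_mono_enumerate enumerate_in_set)
    define w' where "w' k = sym_diff (w (r k)) (w (r (Suc k)))" for k
    have "ladder (commuting_sets E) (v \<circ> r) w'"
      unfolding ladder_def
    proof (intro conjI allI impI)
      fix k
      have "commuting_sets E (v (r k)) (w (r (Suc k)))"
        using r(1) by (intro ladder_above[OF lad]) (simp add: strict_mono_def)
      then show "\<not> commuting_sets E ((v \<circ> r) k) (w' k)"
        using commuting_sets_sym_diff[of E "v (r k)" "w (r (Suc k))" "w (r k)"] ladder_diag[OF lad]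
        by (simp add: w'_def Un_commute)
    next
      fix j k :: nat assume "j < k"
      then have "commuting_sets E (v (r j)) (w (r k))" "commuting_sets E (v (r j)) (w (r (Suc k)))"
        using r(1) by (auto intro!: ladder_above[OF lad] simp: strict_mono_def)
      then show "commuting_sets E ((v \<circ> r) j) (w' k)"
        by (simp add: w'_def commuting_sets_sym_diff)
    qed
    moreover have "E c y" if "y \<in> w' k" for k y
    proof -
      have "v 0 \<subseteq> w (r l)" "joined E (v 0) (w (r l) - v 0)" for l
        using r(2)[of l] dich[of "r l"] c independent[of c 0 c] by (auto simp: L_def joined_def)
      then show ?thesis
        using that c unfolding w'_def joined_def by blast
    qed
    ultimately show ?thesis
      using graph_ladder_in_neighbourhood[of "v \<circ> r" w' c] independent by auto
  next
    case False
    then obtain n where n: "\<And>k. k \<in> L \<Longrightarrow> k < n"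
      by (metis finite_nat_set_iff_bounded)
    have "E c y" if "y \<in> w (k + Suc n)" for k y
      using that n[of "k + Suc n"] dich[of "k + Suc n"] c unfolding L_def joined_def by auto
    then show ?thesis
      using graph_ladder_in_neighbourhood[OF ladder_tail[OF lad, of "Suc n"], of c] independent by blast
  qed
qed

end

section \<open>A translation-invariant bipartite graph without ladders\<close>

type_synonym vertex = "(int \<times> int) \<times> bool"

definition cayley_bipartite :: "(int \<times> int) set \<Rightarrow> vertex \<Rightarrow> vertex \<Rightarrow> bool" where
  "cayley_bipartite S x y \<longleftrightarrow>
    (\<not> snd x \<and> snd y \<and> fst y - fst x \<in> S) \<or> (snd x \<and> \<not> snd y \<and> fst x - fst y \<in> S)"

lemma triangle_free_cayley_bipartite: "triangle_free (cayley_bipartite S)"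
  by unfold_locales (auto simp: cayley_bipartite_def)

text \<open>
  Adjacent vertices lie on different sides, so all \<open>a k\<close> lie on one side and all \<open>b k\<close>, except
  possibly \<open>b 0\<close>, on the other.  Negating positions while exchanging the sides preserves adjacency,
  so the side of the \<open>a k\<close> may be taken to be the left one.
\<close>

lemma ladder_between_sides:
  assumes lad: "ladder (cayley_bipartite S) a b"
  shows "\<exists>p q. ladder (\<lambda>p q. q - p \<in> S) p q"
proof -
  \<comment> \<open>The side of \<open>b 0\<close> is not controlled by any adjacency, hence the shift by one.\<close>
  define a' b' where "a' k = a (Suc k)" and "b' k = b (Suc k)" for k
  have lad': "ladder (cayley_bipartite S) a' b'"
    using ladder_tail[OF lad, of 1] by (simp add: a'_def[abs_def] b'_def[abs_def])
  have side_b: "snd (b' k) = (\<not> snd (a 0))" for k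
    using ladder_above[OF lad, of 0 "Suc k"] by (auto simp: b'_def cayley_bipartite_def)
  have side_a: "snd (a' k) = snd (a 0)" for k
    using ladder_above[OF lad', of k "Suc k"] side_b[of "Suc k"] by (auto simp: cayley_bipartite_def)
  show ?thesis
  proof (cases "snd (a 0)")
    case False
    then have "ladder (\<lambda>p q. q - p \<in> S) (fst \<circ> a') (fst \<circ> b')"
      using lad' side_a side_b by (simp add: ladder_def cayley_bipartite_def)
    then show ?thesis by blast
  next
    case True
    then have "ladder (\<lambda>p q. q - p \<in> S) (\<lambda>k. - fst (a' k)) (\<lambda>k. - fst (b' k))"
      using lad' side_a side_b by (simp add: ladder_def cayley_bipartite_def)
    then show ?thesis by blast
  qed
qed

text \<open>
  A nonzero difference of two values of \<open>s\<close> on \<open>D\<close> determines both arguments.  If \<open>s\<close> is injective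
  on \<open>D\<close>, this means that its image is a Sidon set.
\<close>

definition sidon :: "('i \<Rightarrow> int) \<Rightarrow> 'i set \<Rightarrow> bool" where
  "sidon s D \<longleftrightarrow> (\<forall>i\<in>D. \<forall>j\<in>D. \<forall>k\<in>D. \<forall>l\<in>D.
     s i - s j = s k - s l \<longrightarrow> s i \<noteq> s j \<longrightarrow> i = k \<and> j = l)"

lemma sidonD:
  "sidon s D \<Longrightarrow> i \<in> D \<Longrightarrow> j \<in> D \<Longrightarrow> k \<in> D \<Longrightarrow> l \<in> D \<Longrightarrow>
    s i - s j = s k - s l \<Longrightarrow> s i \<noteq> s j \<Longrightarrow> i = k \<and> j = l"
  unfolding sidon_def by blast

lemma sum_of_two_powers_unique:
  fixes i j k l :: nat
  assumes eq: "2 ^ i + 2 ^ l = (2 ^ k + 2 ^ j :: nat)" and le: "l \<le> i" "j \<le> k"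
  shows "i = k \<and> l = j"
proof -
  have "\<not> i < k" if "2 ^ i + 2 ^ l = (2 ^ k + 2 ^ j :: nat)" "l \<le> i" for i j k l :: nat
  proof
    assume "i < k"
    then have "2 ^ Suc i \<le> (2 ^ k :: nat)"
      by (intro power_increasing) auto
    moreover have "2 ^ l \<le> (2 ^ i :: nat)"
      using that by (intro power_increasing) auto
    moreover have "0 < (2 ^ j :: nat)"
      by simp
    ultimately show False
      using that(1) unfolding power_Suc by linarith
  qed
  from this[OF eq le(1)] this[OF eq[symmetric] le(2)] have "i = k"
    by simp
  then show ?thesis
    using eq by simp
qed

text \<open>
  Moving the negative terms to the other side turns equal differences into equal sums of two powers
  of two, which are unique up to the order of the summands; the other order is excluded because the
  difference is nonzero.
\<close>

lemma sidon_powers_of_two: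
  assumes "inj_on e D"
  shows "sidon (\<lambda>i. 2 ^ e i) D"
proof -
  have *: "i = k \<and> j = l" if eq: "2 ^ i + 2 ^ l = (2 ^ k + 2 ^ j :: nat)" and ne: "i \<noteq> j"
    for i j k l :: nat
    using sum_of_two_powers_unique[of i l k j] sum_of_two_powers_unique[of i l j k]
      sum_of_two_powers_unique[of l i k j] sum_of_two_powers_unique[of l i j k] eq ne
    by (cases "l \<le> i"; cases "j \<le> k") (auto simp: add.commute)
  show ?thesis
    unfolding sidon_def
  proof (intro ballI impI)
    fix i j k l assume D: "i \<in> D" "j \<in> D" "k \<in> D" "l \<in> D"
      and eq: "2 ^ e i - 2 ^ e j = (2 ^ e k - 2 ^ e l :: int)" and ne: "2 ^ e i \<noteq> (2 ^ e j :: int)"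
    have "int (2 ^ e i + 2 ^ e l) = int (2 ^ e k + 2 ^ e j)"
      using eq by simp
    then have "2 ^ e i + 2 ^ e l = (2 ^ e k + 2 ^ e j :: nat)"
      using of_nat_eq_iff by blast
    moreover have "e i \<noteq> e j"
      using ne by auto
    ultimately have "e i = e k \<and> e j = e l"
      by (rule *)
    then show "i = k \<and> j = l"
      using inj_onD[OF assms] D by blast
  qed
qed

definition sum_set :: "('i \<Rightarrow> int) \<Rightarrow> 'i set \<Rightarrow> ('i \<Rightarrow> 'i \<Rightarrow> bool) \<Rightarrow> (int \<times> int) set" where
  "sum_set s D R = {(s i, s j) | i j. i \<in> D \<and> j \<in> D \<and> R i j}"

lemma sum_set_converse: "(x, y) \<in> sum_set s D (\<lambda>i j. R j i) \<longleftrightarrow> (y, x) \<in> sum_set s D R"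
  by (auto simp: sum_set_def)

text \<open>
  Two vertices \<open>p\<close>, \<open>p'\<close> with different first coordinates pin down the first coordinate of all
  their common neighbours: the difference of the first coordinates has a single representation.
\<close>

lemma common_neighbours_fst_eq:
  assumes sidon: "sidon s D"
    and mem: "q - p \<in> sum_set s D R" "q - p' \<in> sum_set s D R"
      "q' - p \<in> sum_set s D R" "q' - p' \<in> sum_set s D R"
    and ne: "fst p \<noteq> fst p'"
  shows "fst q = fst q'"
proof -
  obtain i i' k k' where D: "i \<in> D" "i' \<in> D" "k \<in> D" "k' \<in> D"
    and eq: "fst q - fst p = s i" "fst q - fst p' = s i'" "fst q' - fst p = s k" "fst q' - fst p' = s k'"
    using mem by (auto simp: sum_set_def prod_eq_iff)
  have "i = k"
    using sidonD[OF sidon D(1,2,3,4)] eq ne by linarith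
  then have "fst q - fst p = fst q' - fst p"
    using eq(1,3) by simp
  then show ?thesis
    by simp
qed

lemma common_neighbours_snd_eq:
  assumes sidon: "sidon s D"
    and mem: "q - p \<in> sum_set s D R" "q - p' \<in> sum_set s D R"
      "q' - p \<in> sum_set s D R" "q' - p' \<in> sum_set s D R"
    and ne: "snd p \<noteq> snd p'"
  shows "snd q = snd q'"
proof -
  have "prod.swap a - prod.swap b \<in> sum_set s D (\<lambda>i j. R j i)" if "a - b \<in> sum_set s D R" for a b
    using that sum_set_converse[of "snd (a - b)" "fst (a - b)" s D R]
    by (simp add: prod.swap_def minus_prod_def)
  then show ?thesis
    using common_neighbours_fst_eq[OF sidon, of "prod.swap q" "prod.swap p" "\<lambda>i j. R j i"
        "prod.swap p'" "prod.swap q'"] mem ne by simp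
qed

text \<open>
  If all left-hand vertices are on a horizontal line, all common neighbours of the first two are on
  one vertical line.  Each left-hand vertex is then determined by its signed distance from that
  vertical line, each right-hand vertex by its signed distance from the horizontal line, and these
  distances are values of \<open>s\<close> at the elements that form a ladder of \<open>R\<close>.
\<close>

lemma relation_ladder_if_collinear:
  assumes sidon: "sidon s D" and inj: "inj_on s D"
    and lad: "ladder (\<lambda>p q. q - p \<in> sum_set s D R) p q"
    and line: "\<And>k. snd (p k) = snd (p 0)"
  shows "\<exists>f g. range f \<subseteq> D \<and> range g \<subseteq> D \<and> ladder R f g"
proof -
  have "fst (p 0) \<noteq> fst (p 1)"
    using injD[OF inj_ladder_left[OF lad], of 0 1] line[of 1] by (auto simp: prod_eq_iff)
  \<comment> \<open>Only from index 2 on are the right-hand vertices known to be adjacent to both \<open>p 0\<close> and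
    \<open>p 1\<close>; hence the shifts by 2 below.\<close>
  then have fst_q: "fst (q l) = fst (q 2)" if "1 < l" for l
    using common_neighbours_fst_eq[OF sidon ladder_above[OF lad, of 0 l] ladder_above[OF lad, of 1 l]
        ladder_above[OF lad, of 0 2] ladder_above[OF lad, of 1 2]] that by simp
  have "\<exists>i\<in>D. fst (q 2) - fst (p (k + 2)) = s i" for k
    using ladder_above[OF lad, of "k + 2" "k + 3"] fst_q[of "k + 3"] by (auto simp: sum_set_def prod_eq_iff)
  then obtain f where f: "\<And>k. f k \<in> D" "\<And>k. fst (q 2) - fst (p (k + 2)) = s (f k)"
    by metis
  have "\<exists>j\<in>D. snd (q (k + 2)) - snd (p 0) = s j" for k
    using ladder_above[OF lad, of 0 "k + 2"] by (auto simp: sum_set_def prod_eq_iff)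
  then obtain g where g: "\<And>k. g k \<in> D" "\<And>k. snd (q (k + 2)) - snd (p 0) = s (g k)"
    by metis
  have "q (k + 2) - p (j + 2) = (s (f j), s (g k))" for j k
    using f(2)[of j] g(2)[of k] fst_q[of "k + 2"] line[of "j + 2"] by (simp add: prod_eq_iff)
  moreover have "(s (f j), s (g k)) \<in> sum_set s D R \<longleftrightarrow> R (f j) (g k)" for j k
    using f(1)[of j] g(1)[of k] inj_onD[OF inj] by (auto simp: sum_set_def)
  ultimately have "ladder R f g"
    using ladder_tail[OF lad, of 2] by (simp add: ladder_def)
  then show ?thesis
    using f(1) g(1) by blast
qed

text \<open>
  Two left-hand vertices that differ in both coordinates have at most one common neighbour, but
  later right-hand vertices provide infinitely many.  So any two left-hand vertices share a
  coordinate, and by distinctness all of them share the same one.  Exchanging the coordinates reduces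
  the vertical case to the horizontal one and replaces \<open>R\<close> by its converse.
\<close>

lemma relation_ladder_if_translation_ladder:
  assumes sidon: "sidon s D" and inj: "inj_on s D"
    and lad: "ladder (\<lambda>p q. q - p \<in> sum_set s D R) p q"
  shows "\<exists>f g. range f \<subseteq> D \<and> range g \<subseteq> D \<and> (ladder R f g \<or> ladder (\<lambda>x y. R y x) f g)"
proof -
  have distinct: "p i \<noteq> p j" if "i < j" for i j
    using injD[OF inj_ladder_left[OF lad], of i j] that by auto
  have share: "fst (p i) = fst (p j) \<or> snd (p i) = snd (p j)" if "i < j" for i j
  proof (rule ccontr)
    let ?l = "Suc j" and ?l' = "Suc (Suc j)"
    note above = ladder_above[OF lad, of i ?l] ladder_above[OF lad, of j ?l]
      ladder_above[OF lad, of i ?l'] ladder_above[OF lad, of j ?l']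
    assume "\<not> ?thesis"
    then have "q ?l = q ?l'"
      using common_neighbours_fst_eq[OF sidon above] common_neighbours_snd_eq[OF sidon above] that
      by (simp add: prod_eq_iff)
    then show False
      using injD[OF inj_ladder_right[OF lad], of ?l ?l'] by simp
  qed
  show ?thesis
  proof (cases "snd (p 0) = snd (p 1)")
    case True
    then have "snd (p k) = snd (p 0)" for k
      using share[of 0 k] share[of 1 k] distinct[of 0 1]
      by (cases "k = 0 \<or> k = 1") (auto simp: prod_eq_iff)
    then show ?thesis
      using relation_ladder_if_collinear[OF sidon inj lad] by blast
  next
    case False
    then have "fst (p k) = fst (p 0)" for k
      using share[of 0 k] share[of 1 k] share[of 0 1]
      by (cases "k = 0 \<or> k = 1") (auto simp: prod_eq_iff)
    moreover have "ladder (\<lambda>p q. q - p \<in> sum_set s D (\<lambda>i j. R j i)) (prod.swap \<circ> p) (prod.swap \<circ> q)"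
      using lad sum_set_converse[of _ _ s D R]
      by (simp add: ladder_def prod.swap_def minus_prod_def)
    ultimately show ?thesis
      using relation_ladder_if_collinear[OF sidon inj, of "\<lambda>i j. R j i" "prod.swap \<circ> p" "prod.swap \<circ> q"]
      by auto
  qed
qed

definition descending_lists :: "'a :: wellorder \<Rightarrow> 'a list set" where
  "descending_lists a = {xs. sorted_wrt (>) xs \<and> set xs \<subseteq> {..<a}}"

lemma no_ladder_below_prefix: "\<not> ladder (\<lambda>x y. prefix y x) f g"
proof
  assume lad: "ladder (\<lambda>x y. prefix y x) f g"
  have "g (Suc k) \<in> {xs. prefix xs (f 0)}" for k
    using ladder_above[OF lad, of 0 "Suc k"] by simp
  then have "range (g \<circ> Suc) \<subseteq> {xs. prefix xs (f 0)}"
    by auto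
  moreover have "finite {xs. prefix xs (f 0)}"
    by (metis List.finite_set set_prefixes_eq)
  moreover have "inj (g \<circ> Suc)"
    using inj_ladder_right[OF lad] by (intro inj_compose) auto
  ultimately show False
    using finite_subset range_inj_infinite by blast
qed

text \<open>
  The left-hand sides of a ladder are pairwise comparable, as any two are prefixes of a common
  list, and there are infinitely many of them; so each has a proper extension among them.  But
  extending a descending list decreases its last entry.
\<close>

lemma no_ladder_prefix:
  assumes range: "range f \<subseteq> descending_lists a"
  shows "\<not> ladder prefix f g"
proof
  assume lad: "ladder prefix f g"
  have inj: "inj f"
    using inj_ladder_left[OF lad] .
  have comparable: "prefix (f j) (f k) \<or> prefix (f k) (f j)" for j k
    by (rule prefix_same_cases[of _ "g (Suc (max j k))"]) (auto intro: ladder_above[OF lad])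
  have longer: "\<exists>k. strict_prefix (f j) (f k)" for j
  proof (rule ccontr)
    assume "\<not> ?thesis"
    then have "prefix (f k) (f j)" for k
      using comparable[of j k] by (auto simp: strict_prefix_def)
    then have "range f \<subseteq> {xs. prefix xs (f j)}"
      by blast
    moreover have "finite {xs. prefix xs (f j)}"
      by (metis List.finite_set set_prefixes_eq)
    ultimately show False
      using finite_subset range_inj_infinite[OF inj] by blast
  qed
  let ?P = "\<lambda>b. \<exists>k. f k \<noteq> [] \<and> last (f k) = b"
  obtain k where "strict_prefix (f 0) (f k)"
    using longer by blast
  then have "f k \<noteq> []"
    by auto
  then have "?P (last (f k))"
    by blast
  then have "?P (LEAST b. ?P b)"
    by (rule LeastI)
  then obtain j where j: "f j \<noteq> []" "last (f j) = (LEAST b. ?P b)"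
    by blast
  obtain k xs where k: "f k = f j @ xs" "xs \<noteq> []"
    using longer[of j] by (auto simp: strict_prefix_def prefix_def)
  have "sorted_wrt (>) (f j @ xs)"
    using range unfolding k(1)[symmetric] descending_lists_def by blast
  then have "last xs < last (f j)"
    using k(2) j(1) unfolding sorted_wrt_append by (meson last_in_set)
  moreover have "?P (last xs)"
    using k by (intro exI[of _ k]) simp
  then have "last (f j) \<le> last xs"
    unfolding j(2) by (rule Least_le)
  ultimately show False
    by simp
qed

section \<open>The class-two group of a graph, extended by translations\<close>

definition shift :: "int \<times> int \<Rightarrow> vertex \<Rightarrow> vertex" where
  "shift q x = (fst x + q, snd x)"

definition shift_pair :: "int \<times> int \<Rightarrow> vertex \<times> vertex \<Rightarrow> vertex \<times> vertex" where
  "shift_pair q = map_prod (shift q) (shift q)"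

lemma shift_0 [simp]: "shift 0 x = x"
  and shift_shift [simp]: "shift p (shift q x) = shift (p + q) x"
  by (simp_all add: shift_def ac_simps)

lemma inj_shift: "inj (shift q)"
  by (rule injI) (simp add: shift_def prod_eq_iff)

type_synonym mekler = "(int \<times> int) \<times> vertex set \<times> (vertex \<times> vertex) set"

definition translate :: "int \<times> int \<Rightarrow> vertex set \<Rightarrow> vertex set" where
  "translate q v = {x. shift (- q) x \<in> v}"

definition translate2 :: "int \<times> int \<Rightarrow> (vertex \<times> vertex) set \<Rightarrow> (vertex \<times> vertex) set" where
  "translate2 q z = {(x, y). (shift (- q) x, shift (- q) y) \<in> z}"

lemma translate_image: "translate q v = shift q ` v"
  by (force simp: translate_def image_iff intro: bexI[of _ "shift (- q) _"])

lemma translate2_image: "translate2 q z = shift_pair q ` z"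
proof -
  have "(x, y) = shift_pair q (shift (- q) x, shift (- q) y)" for x y
    by (simp add: shift_pair_def)
  then show ?thesis
    by (force simp: translate2_def shift_pair_def)
qed

lemma translate_0 [simp]: "translate 0 v = v"
  and translate2_0 [simp]: "translate2 0 z = z"
  by (simp_all add: translate_def translate2_def)

lemma finite_translate [simp]: "finite v \<Longrightarrow> finite (translate q v)"
  and finite_translate2 [simp]: "finite z \<Longrightarrow> finite (translate2 q z)"
  by (simp_all add: translate_image translate2_image)

text \<open>
  Summing the positions \<open>f\<close> over the finite set \<open>A\<close>, which \<open>h\<close> permutes, before and after moving
  all of them by \<open>q\<close> gives \<open>card A * q = 0\<close>.
\<close>

lemma shift_free:
  fixes f :: "'a \<Rightarrow> int \<times> int"
  assumes "finite A" "A \<noteq> {}" and bij: "h ` A = A" "inj_on h A"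
    and move: "\<And>x. x \<in> A \<Longrightarrow> f (h x) = f x + q"
  shows "q = 0"
proof -
  have "c q = 0" if "\<And>x y. c (x + y) = c x + c y" for c :: "int \<times> int \<Rightarrow> int"
  proof -
    have "(\<Sum>x\<in>A. c (f x)) = (\<Sum>x\<in>A. c (f (h x)))"
      using sum.reindex[OF bij(2), of "\<lambda>x. c (f x)"] bij(1) by simp
    also have "\<dots> = (\<Sum>x\<in>A. c (f x)) + int (card A) * c q"
      using move that by (simp add: sum.distrib)
    finally show ?thesis
      using assms(1,2) by simp
  qed
  from this[of fst] this[of snd] show ?thesis
    by (simp add: prod_eq_iff)
qed

lemma translate_invariant_empty:
  assumes "finite v" "translate q v = v" "q \<noteq> 0"
  shows "v = {}"
  using shift_free[of v "shift q" fst q] assms inj_on_subset[OF inj_shift subset_UNIV]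
  by (auto simp: translate_image shift_def)

lemma translate2_invariant_empty:
  assumes "finite z" "translate2 q z = z" "q \<noteq> 0"
  shows "z = {}"
proof -
  have "inj (shift_pair q)"
    unfolding shift_pair_def by (intro prod.inj_map inj_shift)
  then have "inj_on (shift_pair q) z"
    using inj_on_subset by blast
  moreover have "fst (fst (shift_pair q e)) = fst (fst e) + q" for e
    by (simp add: shift_pair_def shift_def)
  ultimately show ?thesis
    using shift_free[of z "shift_pair q" "fst \<circ> fst" q] assms by (auto simp: translate2_image)
qed

definition nonadjacent_pairs ::
    "(vertex \<Rightarrow> vertex \<Rightarrow> bool) \<Rightarrow> vertex set \<Rightarrow> vertex set \<Rightarrow> (vertex \<times> vertex) set" where
  "nonadjacent_pairs E v w = {(x, y). x \<in> v \<and> y \<in> w \<and> \<not> E x y}"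

lemma mem_nonadjacent_pairs: "(x, y) \<in> nonadjacent_pairs E v w \<longleftrightarrow> x \<in> v \<and> y \<in> w \<and> \<not> E x y"
  by (simp add: nonadjacent_pairs_def)

text \<open>
  In the manner of Mekler's coding of graphs by groups of nilpotency class two: an element consists
  of a translation, a vector \<open>v\<close> over the field with two elements, indexed by vertices, and a vector
  \<open>z\<close> indexed by ordered pairs of vertices.  The elements with trivial translation form the central
  extension of the group of vectors \<open>v\<close> by that of the vectors \<open>z\<close> which is given by the bilinear
  cocycle \<open>nonadjacent_pairs\<close>; its antisymmetrization is the commutator.  The translations act on
  this extension.
\<close>

definition mekler_group :: "(vertex \<Rightarrow> vertex \<Rightarrow> bool) \<Rightarrow> mekler monoid" where
  "mekler_group E =
    \<lparr>carrier = {(q, v, z). finite v \<and> finite z},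
     mult = (\<lambda>(p, v, z) (q, v', z'). (p + q, sym_diff v (translate p v'),
       sym_diff (sym_diff z (translate2 p z')) (nonadjacent_pairs E v (translate p v')))),
     one = (0, {}, {})\<rparr>"

lemma mult_mekler_group:
  "(p, v, z) \<otimes>\<^bsub>mekler_group E\<^esub> (q, v', z') = (p + q, sym_diff v (translate p v'),
     sym_diff (sym_diff z (translate2 p z')) (nonadjacent_pairs E v (translate p v')))"
  by (simp add: mekler_group_def)

lemma one_mekler_group: "\<one>\<^bsub>mekler_group E\<^esub> = (0, {}, {})"
  by (simp add: mekler_group_def)

lemma carrier_mekler_group: "(q, v, z) \<in> carrier (mekler_group E) \<longleftrightarrow> finite v \<and> finite z"
  by (simp add: mekler_group_def)

locale invariant_graph =
  fixes E :: "vertex \<Rightarrow> vertex \<Rightarrow> bool"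
  assumes shift_invariant: "E (shift q x) (shift q y) \<longleftrightarrow> E x y"
begin

abbreviation "H \<equiv> mekler_group E"

lemma group_mekler: "group H"
proof (rule groupI)
  fix g h assume "g \<in> carrier H" "h \<in> carrier H"
  moreover have "finite (nonadjacent_pairs E v w)" if "finite v" "finite w" for v w
    by (rule finite_subset[of _ "v \<times> w"]) (auto simp: nonadjacent_pairs_def that)
  ultimately show "g \<otimes>\<^bsub>H\<^esub> h \<in> carrier H"
    by (cases g rule: prod_cases3; cases h rule: prod_cases3) (simp add: mult_mekler_group carrier_mekler_group)
next
  show "\<one>\<^bsub>H\<^esub> \<in> carrier H"
    by (simp add: one_mekler_group carrier_mekler_group)
next
  fix g h k :: mekler
  obtain p v z q v' z' r v'' z'' where g: "g = (p, v, z)" "h = (q, v', z')" "k = (r, v'', z'')"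
    by (metis prod_cases3)
  have sym_diff_iff: "x \<in> sym_diff A B \<longleftrightarrow> (x \<in> A) \<noteq> (x \<in> B)" for x :: 'a and A B
    by blast
  have E: "E (shift (- p) x) (shift (- p) y) \<longleftrightarrow> E x y" for x y
    using shift_invariant[of "- p" x y] by simp
  have v_eq: "sym_diff (sym_diff v (translate p v')) (translate (p + q) v'') =
      sym_diff v (translate p (sym_diff v' (translate q v'')))" (is "?L = ?R")
  proof (rule Set.set_eqI)
    show "x \<in> ?L \<longleftrightarrow> x \<in> ?R" for x
      unfolding sym_diff_iff translate_def mem_Collect_eq shift_shift minus_add_distrib
        add.commute[of "- q"] by blast
  qed
  have z_eq: "sym_diff (sym_diff (sym_diff (sym_diff z (translate2 p z'))
        (nonadjacent_pairs E v (translate p v'))) (translate2 (p + q) z''))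
        (nonadjacent_pairs E (sym_diff v (translate p v')) (translate (p + q) v'')) =
     sym_diff (sym_diff z (translate2 p (sym_diff (sym_diff z' (translate2 q z''))
        (nonadjacent_pairs E v' (translate q v'')))))
        (nonadjacent_pairs E v (translate p (sym_diff v' (translate q v''))))" (is "?L = ?R")
  proof (rule Set.set_eqI)
    fix e :: "vertex \<times> vertex"
    obtain x y where e: "e = (x, y)"
      by (cases e)
    \<comment> \<open>At a fixed pair of vertices this is the distributivity of conjunction over exclusive or.\<close>
    show "e \<in> ?L \<longleftrightarrow> e \<in> ?R"
      unfolding e sym_diff_iff translate_def translate2_def nonadjacent_pairs_def mem_Collect_eq
        prod.case E shift_shift minus_add_distrib add.commute[of "- q"]
      by argo
  qed
  show "g \<otimes>\<^bsub>H\<^esub> h \<otimes>\<^bsub>H\<^esub> k = g \<otimes>\<^bsub>H\<^esub> (h \<otimes>\<^bsub>H\<^esub> k)"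
    unfolding g mult_mekler_group prod.inject using v_eq z_eq by (simp only: add.assoc)
next
  fix g assume "g \<in> carrier H"
  then show "\<one>\<^bsub>H\<^esub> \<otimes>\<^bsub>H\<^esub> g = g"
    by (cases g rule: prod_cases3) (simp add: mult_mekler_group one_mekler_group nonadjacent_pairs_def)
next
  fix g assume g: "g \<in> carrier H"
  obtain q v z where qvz: "g = (q, v, z)"
    by (cases g rule: prod_cases3)
  let ?v = "translate (- q) v"
  let ?h = "(- q, ?v, sym_diff (translate2 (- q) z) (nonadjacent_pairs E ?v ?v)) :: mekler"
  have "finite (nonadjacent_pairs E ?v ?v)"
    by (rule finite_subset[of _ "?v \<times> ?v"]) (use g qvz in \<open>auto simp: nonadjacent_pairs_def carrier_mekler_group\<close>)
  then have "?h \<in> carrier H"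
    using g qvz by (simp add: carrier_mekler_group)
  moreover have "?h \<otimes>\<^bsub>H\<^esub> g = \<one>\<^bsub>H\<^esub>"
    by (auto simp: qvz mult_mekler_group one_mekler_group)
  ultimately show "\<exists>h\<in>carrier H. h \<otimes>\<^bsub>H\<^esub> g = \<one>\<^bsub>H\<^esub>"
    by blast
qed

lemma commuting_vertex_sets_iff:
  "commuting H (0, v, z) (0, w, z') \<longleftrightarrow> commuting_sets E v w"
proof -
  have "commuting H (0, v, z) (0, w, z') \<longleftrightarrow> nonadjacent_pairs E v w = nonadjacent_pairs E w v"
    unfolding mult_mekler_group by auto
  also have "\<dots> \<longleftrightarrow> commuting_sets E v w"
  proof
    assume eq: "nonadjacent_pairs E v w = nonadjacent_pairs E w v"
    show "commuting_sets E v w"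
      unfolding commuting_sets_def
    proof (intro allI impI)
      fix x y assume "\<not> E x y"
      then show "x \<in> v \<and> y \<in> w \<longleftrightarrow> x \<in> w \<and> y \<in> v"
        using eq mem_nonadjacent_pairs by metis
    qed
  next
    assume comm: "commuting_sets E v w"
    show "nonadjacent_pairs E v w = nonadjacent_pairs E w v"
    proof (rule Set.set_eqI)
      fix e :: "vertex \<times> vertex"
      show "e \<in> nonadjacent_pairs E v w \<longleftrightarrow> e \<in> nonadjacent_pairs E w v"
        using comm unfolding commuting_sets_def
        by (cases e) (metis mem_nonadjacent_pairs)
    qed
  qed
  finally show ?thesis .
qed

lemma commuting_iff_commuting_sets:
  assumes "fst g = 0" "fst h = 0"
  shows "commuting H g h \<longleftrightarrow> commuting_sets E (fst (snd g)) (fst (snd h))"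
proof -
  obtain v z where "g = (0, v, z)"
    using assms(1) by (cases g rule: prod_cases3) auto
  moreover obtain w z' where "h = (0, w, z')"
    using assms(2) by (cases h rule: prod_cases3) auto
  ultimately show ?thesis
    by (simp only: commuting_vertex_sets_iff fst_conv snd_conv)
qed

text \<open>
  No nonempty finite set is invariant under a nonzero translation.  This applies first to the vertex
  set of \<open>h\<close>; once that is empty, the cocycle contributes nothing and it applies to the set of pairs.
\<close>

lemma commuting_moving_fixed:
  assumes carrier: "g \<in> carrier H" "h \<in> carrier H" and comm: "commuting H g h"
    and g: "fst g \<noteq> 0" and h: "fst h = 0"
  shows "h = \<one>\<^bsub>H\<^esub>"
proof -
  obtain q v z where qvz: "g = (q, v, z)"
    by (rule prod_cases3)
  obtain w z' where wz: "h = (0, w, z')"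
    using h by (cases h rule: prod_cases3) auto
  have fin: "finite w" "finite z'" and "q \<noteq> 0"
    using carrier(2) g by (simp_all add: qvz wz carrier_mekler_group)
  have "translate q w = w"
    using comm unfolding qvz wz mult_mekler_group by auto
  then have w: "w = {}"
    using translate_invariant_empty[OF fin(1)] \<open>q \<noteq> 0\<close> by blast
  have "nonadjacent_pairs E v {} = {}" "nonadjacent_pairs E {} v = {}" "translate q {} = {}"
    by (auto simp: nonadjacent_pairs_def translate_def)
  then have "translate2 q z' = z'"
    using comm unfolding qvz wz mult_mekler_group w by auto
  then show ?thesis
    using translate2_invariant_empty[OF fin(2)] \<open>q \<noteq> 0\<close> w wz by (simp add: one_mekler_group)
qed

text \<open>
  The commutator of \<open>a\<close> and \<open>b\<close> commutes with \<open>g\<close> and has no translation part, as translations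
  commute with each other; so it is trivial by the previous lemma.
\<close>

lemma commuting_transitive:
  assumes g: "g \<in> carrier H" "fst g \<noteq> 0"
    and ab: "a \<in> carrier H" "b \<in> carrier H" "commuting H g a" "commuting H g b"
  shows "commuting H a b"
proof -
  interpret group H
    by (rule group_mekler)
  let ?c = "a \<otimes>\<^bsub>H\<^esub> b \<otimes>\<^bsub>H\<^esub> inv\<^bsub>H\<^esub> (b \<otimes>\<^bsub>H\<^esub> a)"
  have fst_mult: "fst (x \<otimes>\<^bsub>H\<^esub> y) = fst x + fst y" for x y
    by (cases x rule: prod_cases3; cases y rule: prod_cases3) (simp add: mult_mekler_group)
  have "fst (inv\<^bsub>H\<^esub> x) = - fst x" if "x \<in> carrier H" for x
    using fst_mult[of "inv\<^bsub>H\<^esub> x" x] that by (simp add: one_mekler_group eq_neg_iff_add_eq_0)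
  then have "fst ?c = 0"
    using ab by (simp add: fst_mult)
  have mult: "commuting H g (x \<otimes>\<^bsub>H\<^esub> y)"
    if "x \<in> carrier H" "y \<in> carrier H" "commuting H g x" "commuting H g y" for x y
    using that g by (metis m_assoc)
  have inv: "commuting H g (inv\<^bsub>H\<^esub> x)" if "x \<in> carrier H" "commuting H g x" for x
    using that g by (metis inv_closed inv_solve_left inv_solve_right m_assoc m_closed)
  have "commuting H g ?c"
    using ab by (intro mult inv) auto
  moreover have "?c \<in> carrier H"
    using ab by simp
  ultimately have "?c = \<one>\<^bsub>H\<^esub>"
    using commuting_moving_fixed[OF g(1)] \<open>fst ?c = 0\<close> g(2) by blast
  then show ?thesis
    using ab by (metis inv_equality inv_inv m_closed inv_closed)
qed

text \<open>
  Suppose that \<open>x k\<close> has a translation part.  Then \<open>y (k + 2)\<close>, which commutes with \<open>x k\<close>, has one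
  as well.  It commutes with \<open>x k\<close> and \<open>x (k + 1)\<close>, so these commute with each other; and
  \<open>x (k + 1)\<close> and \<open>y (k + 1)\<close>, both commuting with \<open>x k\<close>, commute too, a contradiction.  Hence no
  \<open>x k\<close> has a translation part, and then neither has any \<open>y k\<close> with \<open>k > 0\<close>, because it commutes
  with \<open>x 0\<close>.  For elements without translation part, only the vertex sets matter.
\<close>

lemma set_ladder_if_mekler_ladder:
  assumes lad: "ladder (commuting H) x y"
    and x: "range x \<subseteq> carrier H" and y: "range y \<subseteq> carrier H"
  shows "\<exists>v w. (\<forall>k. finite (v k)) \<and> ladder (commuting_sets E) v w"
proof -
  interpret group H
    by (rule group_mekler)
  have carrier: "x k \<in> carrier H" "y k \<in> carrier H" for k
    using x y by auto
  have nontrivial: "x k \<noteq> \<one>\<^bsub>H\<^esub>" "y k \<noteq> \<one>\<^bsub>H\<^esub>" for k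
    using ladder_diag[OF lad, of k] carrier[of k] by (metis l_one r_one)+
  have fixed: "fst g = 0 \<Longrightarrow> fst h = 0"
    if "g \<in> carrier H" "h \<in> carrier H" "commuting H g h" "g \<noteq> \<one>\<^bsub>H\<^esub>" for g h
    using commuting_moving_fixed[OF that(2,1) that(3)[symmetric]] that(4) by blast
  have x0: "fst (x k) = 0" for k
  proof (rule ccontr)
    assume moving: "fst (x k) \<noteq> 0"
    let ?l = "Suc k" and ?m = "Suc (Suc k)"
    have above: "commuting H (x k) (y ?l)" "commuting H (x k) (y ?m)" "commuting H (x ?l) (y ?m)"
      by (rule ladder_above[OF lad], simp)+
    have moving': "fst (y ?m) \<noteq> 0"
      using fixed[OF carrier(2,1) above(2)[symmetric] nontrivial(2)] moving by blast
    have "commuting H (x k) (x ?l)"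
      using commuting_transitive[OF carrier(2) moving' carrier(1,1) above(2,3)[symmetric]] .
    then have "commuting H (x ?l) (y ?l)"
      using commuting_transitive[OF carrier(1) moving carrier _ above(1)] by blast
    then show False
      using ladder_diag[OF lad] by blast
  qed
  have y0: "fst (y (Suc k)) = 0" for k
    using fixed[OF carrier ladder_above[OF lad, of 0 "Suc k"] nontrivial(1) x0] by blast
  let ?v = "\<lambda>k. fst (snd (x (k + 1)))" and ?w = "\<lambda>k. fst (snd (y (k + 1)))"
  have iff: "commuting H (x (j + 1)) (y (k + 1)) \<longleftrightarrow> commuting_sets E (?v j) (?w k)" for j k
    by (rule commuting_iff_commuting_sets) (use x0 y0 in simp_all)
  have "ladder (commuting_sets E) ?v ?w"
    using ladder_tail[OF lad, of 1] unfolding ladder_def iff .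
  moreover have "finite (fst (snd g))" if "g \<in> carrier H" for g
    using that by (cases g rule: prod_cases3) (simp add: carrier_mekler_group)
  then have "\<forall>k. finite (?v k)"
    using carrier(1) by blast
  ultimately show ?thesis
    by (intro exI[of _ ?v] exI[of _ ?w] conjI)
qed

end

lemma invariant_graph_cayley_bipartite: "invariant_graph (cayley_bipartite S)"
  by unfold_locales (auto simp: cayley_bipartite_def shift_def)

definition mekler_generators :: "nat \<Rightarrow> mekler" where
  "mekler_generators = (\<lambda>_. (0, {}, {}))
    (0 := ((1, 0), {}, {}), 1 := ((0, 1), {}, {}),
     2 := (0, {(0, False)}, {}), 3 := (0, {(0, True)}, {}))"

lemma range_mekler_generators: "range mekler_generators \<subseteq> carrier (mekler_group E)"
  by (auto simp: mekler_generators_def carrier_mekler_group)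

lemma finite_mekler_generators: "finite {i. mekler_generators i \<noteq> \<one>\<^bsub>mekler_group E\<^esub>}"
  by (rule finite_subset[of _ "{..3}"]) (auto simp: mekler_generators_def one_mekler_group)

context invariant_graph
begin

lemma subgroup_containing_translations:
  assumes K: "subgroup K H" and "((1, 0), {}, {}) \<in> K" "((0, 1), {}, {}) \<in> K"
  shows "(q, {}, {}) \<in> K"
proof -
  interpret group H
    by (rule group_mekler)
  interpret K: subgroup K H
    by (rule K)
  let ?T = "\<lambda>q. (q, {}, {}) \<in> K"
  have mult: "(p, {}, {}) \<otimes>\<^bsub>H\<^esub> (q, {}, {}) = (p + q, {}, {})" for p q
    by (simp add: mult_mekler_group translate_def translate2_def nonadjacent_pairs_def)
  have inv: "inv\<^bsub>H\<^esub> (q, {}, {}) = (- q, {}, {})" for q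
    by (rule inv_equality) (simp_all add: mult one_mekler_group carrier_mekler_group)
  have diff: "?T (p + q)" "?T (p - q)" if "?T p" "?T q" for p q
    using K.m_closed[OF that] K.m_closed[OF that(1) K.m_inv_closed[OF that(2)]] by (simp_all add: mult inv)
  have zero: "?T 0"
    using K.one_closed by (simp add: one_mekler_group)
  have "?T (m, 0)" for m
  proof (induction m rule: int_induct[where k = 0])
    case base
    show ?case using zero by (simp add: zero_prod_def)
  next
    case (step1 i)
    then show ?case using diff(1)[OF _ assms(2), of "(i, 0)"] by (simp add: plus_prod_def)
  next
    case (step2 i)
    then show ?case using diff(2)[OF _ assms(2), of "(i, 0)"] by (simp add: minus_prod_def)
  qed
  moreover have "?T (0, n)" for n
  proof (induction n rule: int_induct[where k = 0])
    case base
    show ?case using zero by (simp add: zero_prod_def)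
  next
    case (step1 i)
    then show ?case using diff(1)[OF _ assms(3), of "(0, i)"] by (simp add: plus_prod_def)
  next
    case (step2 i)
    then show ?case using diff(2)[OF _ assms(3), of "(0, i)"] by (simp add: minus_prod_def)
  qed
  ultimately have "?T ((fst q, 0) + (0, snd q))"
    by (rule diff(1))
  then show ?thesis
    by (simp add: plus_prod_def)
qed

text \<open>
  Each vertex is a translate of the origin of its side, and translation is conjugation by an element
  of \<open>\<int>\<^sup>2\<close>.
\<close>

lemma vertex_generated: "(0, {x}, {}) \<in> generate H (range mekler_generators)"
proof -
  interpret group H
    by (rule group_mekler)
  let ?K = "generate H (range mekler_generators)"
  have K: "subgroup ?K H"
    by (rule generate_is_subgroup[OF range_mekler_generators])
  interpret K: subgroup ?K H
    by (rule K)
  have gen: "mekler_generators i \<in> ?K" for i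
    by (rule generate.incl) (rule rangeI)
  have trans: "(q, {}, {}) \<in> ?K" for q
    using subgroup_containing_translations[OF K] gen[of 0] gen[of 1] by (simp add: mekler_generators_def)
  have "(0, {(0, snd x)}, {}) \<in> ?K"
    using gen[of 2] gen[of 3] by (cases "snd x") (simp_all add: mekler_generators_def)
  then have "(fst x, {}, {}) \<otimes>\<^bsub>H\<^esub> (0, {(0, snd x)}, {}) \<otimes>\<^bsub>H\<^esub> (- fst x, {}, {}) \<in> ?K"
    by (intro K.m_closed trans)
  moreover have "translate (fst x) {(0, snd x)} = {x}"
    by (simp add: translate_image shift_def)
  ultimately show ?thesis
    by (simp add: mult_mekler_group translate2_image nonadjacent_pairs_def) (simp add: translate_def)
qed

end

lemma commuting_vertices_iff:
  assumes "\<not> snd x" "snd y"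
  shows "commuting (mekler_group (cayley_bipartite S)) (0, {x}, {}) (0, {y}, {}) \<longleftrightarrow> fst y - fst x \<in> S"
proof -
  interpret invariant_graph "cayley_bipartite S"
    by (rule invariant_graph_cayley_bipartite)
  have "commuting_sets (cayley_bipartite S) {x} {y} \<longleftrightarrow> cayley_bipartite S x y"
  proof -
    have "x \<noteq> y" "cayley_bipartite S x y \<longleftrightarrow> cayley_bipartite S y x"
      using assms by (auto simp: cayley_bipartite_def)
    then show ?thesis
      unfolding commuting_sets_def singleton_iff by metis
  qed
  then show ?thesis
    unfolding commuting_vertex_sets_iff using assms by (simp add: cayley_bipartite_def)
qed

abbreviation prefix_graph :: "('a :: wellorder list \<Rightarrow> int) \<Rightarrow> 'a \<Rightarrow> vertex \<Rightarrow> vertex \<Rightarrow> bool" where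
  "prefix_graph s a \<equiv> cayley_bipartite (sum_set s (descending_lists a) prefix)"

lemma no_ladder_mekler_group:
  assumes sidon: "sidon s (descending_lists a)" and inj: "inj_on s (descending_lists a)"
    and x: "range x \<subseteq> carrier (mekler_group (prefix_graph s a))"
    and y: "range y \<subseteq> carrier (mekler_group (prefix_graph s a))"
  shows "\<not> ladder (commuting (mekler_group (prefix_graph s a))) x y"
proof
  let ?E = "prefix_graph s a"
  assume lad: "ladder (commuting (mekler_group ?E)) x y"
  obtain v w where "\<forall>k. finite (v k)" "ladder (commuting_sets ?E) v w"
    using invariant_graph.set_ladder_if_mekler_ladder[OF invariant_graph_cayley_bipartite lad x y] by blast
  then obtain b c where "ladder ?E b c"
    using triangle_free.graph_ladder_if_set_ladder[OF triangle_free_cayley_bipartite] by blast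
  then obtain p q where "ladder (\<lambda>p q. q - p \<in> sum_set s (descending_lists a) prefix) p q"
    using ladder_between_sides by blast
  then obtain f g where "range f \<subseteq> descending_lists a" "ladder prefix f g \<or> ladder (\<lambda>x y. prefix y x) f g"
    using relation_ladder_if_translation_ladder[OF sidon inj] by blast
  then show False
    using no_ladder_prefix no_ladder_below_prefix by blast
qed

section \<open>Finitely generated quotients of the free group\<close>

context group
begin

definition letter_val :: "(nat \<Rightarrow> 'a) \<Rightarrow> letter \<Rightarrow> 'a" where
  "letter_val f l = (if snd l then f (fst l) else inv (f (fst l)))"

definition word_val :: "(nat \<Rightarrow> 'a) \<Rightarrow> letter list \<Rightarrow> 'a" where
  "word_val f w = foldr (\<lambda>l a. letter_val f l \<otimes> a) w \<one>"

context
  fixes f :: "nat \<Rightarrow> 'a"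
  assumes f: "range f \<subseteq> carrier G"
begin

lemma letter_val_closed [simp]: "letter_val f l \<in> carrier G"
  using f by (auto simp: letter_val_def)

lemma letter_val_inv_letter: "letter_val f l \<otimes> letter_val f (inv_letter l) = \<one>"
proof -
  have "f (fst l) \<in> carrier G"
    using f by blast
  then show ?thesis
    by (simp add: letter_val_def inv_letter_def)
qed

lemma word_val_closed [simp]: "word_val f w \<in> carrier G"
  by (induction w) (simp_all add: word_val_def)

lemma word_val_Cons: "word_val f (l # w) = letter_val f l \<otimes> word_val f w"
  by (simp add: word_val_def)

text \<open>
  A letter that cancels meets its inverse, and the values of the two cancel as well.
\<close>

lemma word_val_cons_reduced: "word_val f (cons_reduced l w) = letter_val f l \<otimes> word_val f w"
proof (cases w)
  case (Cons m v)
  have "letter_val f l \<otimes> (letter_val f (inv_letter l) \<otimes> word_val f v) = word_val f v"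
    by (simp add: m_assoc[symmetric] letter_val_inv_letter)
  then show ?thesis
    by (simp add: Cons word_val_Cons)
qed (simp add: word_val_Cons)

lemma word_val_hom: "word_val f \<in> hom F_omega G"
proof (rule homI)
  fix v w
  show "word_val f (v \<otimes>\<^bsub>F_omega\<^esub> w) = word_val f v \<otimes> word_val f w"
    unfolding F_omega_def monoid.simps
  proof (induction v)
    case Nil
    show ?case by (simp add: word_val_def[of _ "[]"])
  next
    case (Cons l v)
    then show ?case
      by (simp add: word_val_cons_reduced word_val_Cons m_assoc)
  qed
qed simp

lemma word_val_single: "word_val f [(i, True)] = f i"
proof -
  have "f i \<in> carrier G"
    using f by blast
  then show ?thesis
    by (simp add: word_val_def letter_val_def)
qed

end

end

lemma generate_letters: "generate F_omega (range (\<lambda>i. [(i, True)])) = carrier F_omega"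
proof -
  interpret F: group F_omega
    by (rule group_F_omega)
  let ?L = "range (\<lambda>i. [(i, True)]) :: letter list set"
  have L: "?L \<subseteq> carrier F_omega"
    by (auto simp: F_omega_def)
  interpret K: subgroup "generate F_omega ?L" F_omega
    by (rule F.generate_is_subgroup[OF L])
  have letter: "[l] \<in> generate F_omega ?L" for l :: letter
  proof (cases "snd l")
    case True
    then have "l = (fst l, True)"
      by (simp add: prod_eq_iff)
    then show ?thesis
      by (metis generate.incl rangeI)
  next
    case False
    have "[(fst l, True)] \<in> generate F_omega ?L"
      by (rule generate.incl) (rule rangeI)
    then have "inv\<^bsub>F_omega\<^esub> [(fst l, True)] \<in> generate F_omega ?L"
      by (rule K.m_inv_closed)
    moreover have "inv\<^bsub>F_omega\<^esub> [(fst l, True)] = [l]"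
    proof (rule F.inv_equality)
      have "(fst l, True) = inv_letter l"
        using False by (simp add: inv_letter_def)
      then show "[l] \<otimes>\<^bsub>F_omega\<^esub> [(fst l, True)] = \<one>\<^bsub>F_omega\<^esub>"
        by (simp add: F_omega_def)
    qed (simp_all add: F_omega_def)
    ultimately show ?thesis by simp
  qed
  have "w \<in> generate F_omega ?L" if "reduced w" for w
    using that
  proof (induction w)
    case Nil
    then show ?case
      using K.one_closed by (simp add: F_omega_def)
  next
    case (Cons l w)
    then have "w \<in> generate F_omega ?L"
      using reduced_ConsD by blast
    then have "[l] \<otimes>\<^bsub>F_omega\<^esub> w \<in> generate F_omega ?L"
      using letter K.m_closed by blast
    moreover have "[l] \<otimes>\<^bsub>F_omega\<^esub> w = l # w"
      using Cons.prems by (cases w) (auto simp: F_omega_def)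
    ultimately show ?case by simp
  qed
  then show ?thesis
    using K.subset by (auto simp: F_omega_def)
qed

text \<open>
  The subgroup generated by the values of \<open>f\<close> is the image of \<open>F_omega\<close> under evaluation of words,
  and \<open>N\<close> is the kernel.  The quotient is finitely generated because the letters generate \<open>F_omega\<close>
  and all but finitely many of them lie in \<open>N\<close>.
\<close>

lemma marked_subgroup:
  fixes H :: "('a, 'b) monoid_scheme" and f :: "nat \<Rightarrow> 'a"
  assumes H: "group H" and f: "range f \<subseteq> carrier H" and fin: "finite {i. f i \<noteq> \<one>\<^bsub>H\<^esub>}"
  obtains N \<psi> where "N \<lhd> F_omega" "finitely_generated (F_omega Mod N)"
    "\<psi> \<in> hom (F_omega Mod N) H" "inj_on \<psi> (carrier (F_omega Mod N))"
    "\<And>h. h \<in> generate H (range f) \<Longrightarrow> \<exists>w\<in>carrier F_omega. \<psi> (w <#\<^bsub>F_omega\<^esub> N) = h"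
proof -
  interpret H: group H
    by (rule H)
  interpret \<phi>: group_hom F_omega H "H.word_val f"
    by (intro group_hom.intro group_hom_axioms.intro group_F_omega H H.word_val_hom f)
  let ?N = "kernel F_omega H (H.word_val f)" and ?\<psi> = "\<lambda>X. the_elem (H.word_val f ` X)"
  let ?L = "range (\<lambda>i. [(i, True)]) :: letter list set"
  interpret N: normal ?N F_omega
    by (rule \<phi>.normal_kernel)
  have L: "?L \<subseteq> carrier F_omega"
    by (auto simp: F_omega_def)
  have coset: "?\<psi> (w <#\<^bsub>F_omega\<^esub> ?N) = H.word_val f w" if w: "w \<in> carrier F_omega" for w
  proof -
    have fibre: "H.word_val f (w \<otimes>\<^bsub>F_omega\<^esub> n) = H.word_val f w" if "n \<in> ?N" for n
    proof -
      have n: "n \<in> carrier F_omega" "H.word_val f n = \<one>\<^bsub>H\<^esub>"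
        using that unfolding kernel_def by blast+
      show ?thesis
        unfolding \<phi>.hom_mult[OF w n(1)] n(2) by (rule H.r_one[OF H.word_val_closed[OF f]])
    qed
    have "H.word_val f ` (w <#\<^bsub>F_omega\<^esub> ?N) = (\<lambda>n. H.word_val f w) ` ?N"
      unfolding l_coset_def UNION_singleton_eq_range image_image
      by (rule image_cong[OF refl fibre])
    also have "\<dots> = {H.word_val f w}"
      using N.one_closed by (rule image_constant)
    finally have "H.word_val f ` (w <#\<^bsub>F_omega\<^esub> ?N) = {H.word_val f w}" .
    then show ?thesis
      by (simp only: the_elem_eq)
  qed
  have fg: "finitely_generated (F_omega Mod ?N)"
  proof -
    interpret \<pi>: group_hom F_omega "F_omega Mod ?N" "\<lambda>w. ?N #>\<^bsub>F_omega\<^esub> w"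
      by (intro group_hom.intro group_hom_axioms.intro group_F_omega N.factorgroup_is_group N.r_coset_hom_Mod)
    have "generate (F_omega Mod ?N) ((\<lambda>w. ?N #>\<^bsub>F_omega\<^esub> w) ` ?L)
        = (\<lambda>w. ?N #>\<^bsub>F_omega\<^esub> w) ` carrier F_omega"
      using \<pi>.generate_img[OF L] generate_letters by simp
    also have "\<dots> = carrier (F_omega Mod ?N)"
      by (auto simp: FactGroup_def RCOSETS_def)
    finally have gen: "generate (F_omega Mod ?N) ((\<lambda>w. ?N #>\<^bsub>F_omega\<^esub> w) ` ?L) = carrier (F_omega Mod ?N)" .
    have "?N #>\<^bsub>F_omega\<^esub> [(i, True)] = ?N" if "f i = \<one>\<^bsub>H\<^esub>" for i
    proof (rule N.rcos_const[OF group_F_omega])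
      show "[(i, True)] \<in> ?N"
        unfolding kernel_def mem_Collect_eq H.word_val_single[OF f] using that L by blast
    qed
    then have "(\<lambda>w. ?N #>\<^bsub>F_omega\<^esub> w) ` ?L
        \<subseteq> insert ?N ((\<lambda>i. ?N #>\<^bsub>F_omega\<^esub> [(i, True)]) ` {i. f i \<noteq> \<one>\<^bsub>H\<^esub>})"
      by auto
    then have "finite ((\<lambda>w. ?N #>\<^bsub>F_omega\<^esub> w) ` ?L)"
      using fin finite_subset by (metis finite.insertI finite_imageI)
    moreover have "(\<lambda>w. ?N #>\<^bsub>F_omega\<^esub> w) ` ?L \<subseteq> carrier (F_omega Mod ?N)"
      using L \<pi>.hom_closed by blast
    ultimately show ?thesis
      using gen unfolding finitely_generated_def by blast
  qed
  have surj: "\<exists>w\<in>carrier F_omega. ?\<psi> (w <#\<^bsub>F_omega\<^esub> ?N) = h" if h: "h \<in> generate H (range f)" for h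
  proof -
    have "H.word_val f ` carrier F_omega = generate H (H.word_val f ` ?L)"
      unfolding \<phi>.generate_img[OF L] generate_letters ..
    also have "H.word_val f ` ?L = range f"
      unfolding image_image H.word_val_single[OF f] ..
    finally have "h \<in> H.word_val f ` carrier F_omega"
      using h by (simp only:)
    then obtain w where "w \<in> carrier F_omega" "h = H.word_val f w"
      by (rule imageE)
    then show ?thesis
      using coset by metis
  qed
  show ?thesis
    by (rule that[OF \<phi>.normal_kernel fg \<phi>.FactGroup_hom \<phi>.FactGroup_inj_on surj])
qed

section \<open>A lower bound for the rank of the centralizer tree\<close>

lemma descending_lists_snoc:
  "xs @ [c] \<in> descending_lists a \<longleftrightarrow> xs \<in> descending_lists a \<and> (\<forall>b\<in>set xs. c < b) \<and> c < a"
  by (auto simp: descending_lists_def sorted_wrt_append)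

text \<open>
  A descending list \<open>xs\<close> is sent to the sequence of the indices \<open>U ys\<close>, where \<open>ys\<close> runs through the
  nonempty prefixes of \<open>xs\<close>.  This sequence is in the centralizer tree: the element
  with index \<open>W xs\<close> commutes with those with index \<open>U ys\<close> for all prefixes \<open>ys\<close> of \<open>xs\<close>, but not
  with the one with index \<open>U (xs @ [c])\<close>.  By induction, a node whose
  list can be extended by every \<open>c < b\<close> has rank at least \<open>b\<close>.  If the tree is not well-founded,
  its rank is \<open>omega1\<close> and the bound is trivial.
\<close>

lemma tree_rank_centralizer_tree_ge:
  fixes U W :: "ordinal list \<Rightarrow> nat"
  assumes a: "a < omega1" and g: "range g \<subseteq> carrier G"
    and comm: "\<And>xs ys. xs \<in> descending_lists a \<Longrightarrow> ys \<in> descending_lists a \<Longrightarrow>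
      commuting G (g (U xs)) (g (W ys)) \<longleftrightarrow> prefix xs ys"
  shows "a \<le> tree_rank (centralizer_tree G g)"
proof (cases "well_founded_tree (centralizer_tree G g)")
  case False
  then show ?thesis
    using centralizer_tree.Nil ordinal_le_omega1 by (auto simp: tree_rank_def)
next
  case wf: True
  let ?T = "centralizer_tree G g" and ?D = "descending_lists a"
  note tree = is_tree_centralizer_tree[of G g]
  define node where "node xs = map (\<lambda>n. U (take n xs)) [1..<Suc (length xs)]" for xs
  have node_snoc: "node (xs @ [c]) = node xs @ [U (xs @ [c])]" for xs c
    by (auto simp: node_def)
  have node_Nil: "node [] = []"
    by (simp add: node_def)
  have node_in_tree: "xs \<in> ?D \<Longrightarrow> node xs \<in> ?T" for xs
  proof (induction xs rule: rev_induct)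
    case Nil
    show ?case
      by (simp add: node_Nil centralizer_tree.Nil)
  next
    case (snoc c xs)
    then have xs: "xs \<in> ?D"
      by (simp add: descending_lists_snoc)
    have "g (W xs) \<in> centralizer G (g ` set (node xs))"
    proof -
      have "commuting G (g (W xs)) b" if b: "b \<in> g ` set (node xs)" for b
      proof -
        obtain n where n: "b = g (U (take n xs))"
          using b by (auto simp: node_def simp del: upt_Suc)
        have "take n xs \<in> ?D"
          using xs by (auto simp: descending_lists_def sorted_wrt_take dest: in_set_takeD)
        then show ?thesis
          using comm[OF _ xs] n by (metis take_is_prefix)
      qed
      then show ?thesis
        using g by (auto simp: centralizer_def)
    qed
    moreover have "\<not> commuting G (g (U (xs @ [c]))) (g (W xs))"
      using comm[OF snoc.prems xs] by (auto dest: prefix_length_le)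
    then have "g (W xs) \<notin> centralizer G (g ` set (node xs) \<union> {g (U (xs @ [c]))})"
      by (metis (mono_tags, lifting) UnI2 centralizer_def mem_Collect_eq singletonI)
    ultimately show ?case
      unfolding node_snoc using snoc.IH[OF xs] by (intro centralizer_tree.snoc) auto
  qed
  have rank: "b \<le> node_rank ?T (node xs)"
    if "xs \<in> ?D" "\<And>c. c < b \<Longrightarrow> xs @ [c] \<in> ?D" for b xs
    using that
  proof (induction b arbitrary: xs rule: less_induct)
    case (less b)
    show ?case
    proof (rule ccontr)
      \<comment> \<open>If the rank \<open>?r\<close> of the node were below \<open>b\<close>, the list could be extended by \<open>?r\<close> itself, and the
        extension would have rank at least \<open>?r\<close>, so that the node itself would have a larger rank.\<close>
      let ?r = "node_rank ?T (node xs)"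
      assume "\<not> ?thesis"
      then have r: "?r < b"
        by simp
      let ?s = "node (xs @ [?r])"
      have s: "xs @ [?r] \<in> ?D"
        by (rule less.prems(2)[OF r])
      have "?r \<le> node_rank ?T ?s"
      proof (rule less.IH[OF r s])
        fix d assume "d < ?r"
        then show "(xs @ [?r]) @ [d] \<in> ?D"
          using s unfolding descending_lists_snoc[of "xs @ [?r]"] by (auto simp: descending_lists_snoc)
      qed
      also have "\<dots> < ord_succ (node_rank ?T ?s)"
        by (intro less_ord_succ node_rank_less_omega1 tree wf node_in_tree s)
      also have "\<dots> \<le> (SUP t\<in>{t \<in> ?T. strict_prefix (node xs) t}. ord_succ (node_rank ?T t))"
        using node_in_tree[OF s] by (intro SUP_upper) (simp add: node_snoc strict_prefix_def)
      also have "\<dots> = ?r"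
        by (rule node_rank_eq[OF tree wf node_in_tree[OF less.prems(1)], symmetric])
      finally show False
        by simp
    qed
  qed
  have "a \<le> node_rank ?T (node [])"
    by (rule rank) (auto simp: descending_lists_def)
  also have "\<dots> < ord_succ (node_rank ?T (node []))"
    by (intro less_ord_succ node_rank_less_omega1 tree wf node_in_tree) (simp add: descending_lists_def)
  finally show ?thesis
    using wf centralizer_tree.Nil[of G g] by (auto simp: tree_rank_def node_Nil)
qed

section \<open>Groups with centralizer trees of large rank\<close>

theorem lemma3p11:
  fixes \<gamma> :: "nat \<Rightarrow> letter list" and \<alpha> :: ordinal
  assumes "bij_betw \<gamma> UNIV (carrier F_omega)"
    and "\<alpha> < omega1"
  shows "\<exists>N. N \<lhd> F_omega \<and>
    finitely_generated (F_omega Mod N) \<and>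
    min_condition_centralizers (F_omega Mod N) \<and>
    tree_rank (centralizer_tree (F_omega Mod N) (\<lambda>i. \<gamma> i <#\<^bsub>F_omega\<^esub> N)) \<ge> \<alpha>"
proof -
  let ?D = "descending_lists \<alpha>"
  define s :: "ordinal list \<Rightarrow> int" where "s xs = 2 ^ to_nat_on ?D xs" for xs
  let ?H = "mekler_group (prefix_graph s \<alpha>)"
  interpret invariant_graph "prefix_graph s \<alpha>"
    by (rule invariant_graph_cayley_bipartite)
  have "?D \<subseteq> lists {b. b < \<alpha>}"
    by (auto simp: descending_lists_def)
  then have "countable ?D"
    using less_omega1_imp_countable[OF assms(2)] by (meson countable_lists countable_subset)
  then have code: "inj_on (to_nat_on ?D) ?D"
    by (rule inj_on_to_nat_on)
  have sidon: "sidon s ?D"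
    unfolding s_def[abs_def] by (rule sidon_powers_of_two[OF code])
  have inj: "inj_on s ?D"
    using code by (auto simp: inj_on_def s_def)
  obtain N \<psi> where N: "N \<lhd> F_omega" "finitely_generated (F_omega Mod N)"
    and hom: "\<psi> \<in> hom (F_omega Mod N) ?H" and inj_\<psi>: "inj_on \<psi> (carrier (F_omega Mod N))"
    and surj: "\<And>h. h \<in> generate ?H (range mekler_generators) \<Longrightarrow>
      \<exists>w\<in>carrier F_omega. \<psi> (w <#\<^bsub>F_omega\<^esub> N) = h"
    using marked_subgroup[OF group_mekler range_mekler_generators finite_mekler_generators] by blast
  let ?G = "F_omega Mod N" and ?g = "\<lambda>i. \<gamma> i <#\<^bsub>F_omega\<^esub> N"
  interpret N: normal N F_omega
    by (rule N(1))
  interpret G: group ?G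
    by (rule N.factorgroup_is_group)
  have min: "min_condition_centralizers ?G"
    by (rule min_condition_centralizers_if_embeds[OF hom inj_\<psi> G.is_group
          no_ladder_mekler_group[OF sidon inj]])
  have g: "?g i \<in> carrier ?G" for i
  proof -
    have "\<gamma> i \<in> carrier F_omega"
      using assms(1) by (auto simp: bij_betw_def)
    then show ?thesis
      using N.coset_eq by (auto simp: FactGroup_def RCOSETS_def)
  qed
  have index: "\<exists>i. \<psi> (?g i) = (0, {x}, {})" for x
  proof -
    obtain w where w: "w \<in> carrier F_omega" "\<psi> (w <#\<^bsub>F_omega\<^esub> N) = (0, {x}, {})"
      using surj[OF vertex_generated[of x]] by (rule bexE)
    then obtain i where "w = \<gamma> i"
      using assms(1) by (auto simp: bij_betw_def)
    then show ?thesis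
      using w(2) by blast
  qed
  define vertex_index where "vertex_index x = (SOME i. \<psi> (?g i) = (0, {x}, {}))" for x
  have vertex_index: "\<psi> (?g (vertex_index x)) = (0, {x}, {})" for x
    unfolding vertex_index_def by (rule someI_ex[OF index])
  \<comment> \<open>The left vertex of \<open>xs\<close> and the right vertex of \<open>ys\<close> are placed so that their difference is
    \<open>(s xs, s ys)\<close>.\<close>
  define U W where "U xs = vertex_index ((- s xs, 0), False)" and "W xs = vertex_index ((0, s xs), True)" for xs
  have "commuting ?G (?g (U xs)) (?g (W ys)) \<longleftrightarrow> prefix xs ys" if D: "xs \<in> ?D" "ys \<in> ?D" for xs ys
  proof -
    have "commuting ?G (?g (U xs)) (?g (W ys)) \<longleftrightarrow> commuting ?H (\<psi> (?g (U xs))) (\<psi> (?g (W ys)))"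
      by (rule commuting_hom_iff[OF hom inj_\<psi> G.is_group g g, symmetric])
    also have "\<dots> \<longleftrightarrow> (s xs, s ys) \<in> sum_set s ?D prefix"
      unfolding U_def W_def vertex_index by (subst commuting_vertices_iff) auto
    also have "\<dots> \<longleftrightarrow> prefix xs ys"
      using D inj_onD[OF inj] by (auto simp: sum_set_def)
    finally show ?thesis .
  qed
  then have "\<alpha> \<le> tree_rank (centralizer_tree ?G ?g)"
    using g by (intro tree_rank_centralizer_tree_ge[OF assms(2), where U = U and W = W]) auto
  then show ?thesis
    using N min by blast
qed

end
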